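(* Let $f\in\mathcal{D}'(\mathbb{R}^d)$, $\mathbf{x}_0\in\mathbb{R}^d$, and let $\gamma$ be a constant. Then the distributional point value $f(\mathbf{x}_0)$ exists and equals $\gamma$ if and only if $$\lim_{n\to\infty}\langle f(\mathbf{x}_0+\mathbf{x}),\phi_n(\mathbf{x})\rangle=\gamma$$ for every standard delta sequence $\{\phi_n\}_{n=1}^\infty$ generated by a positive normalized test function of $\mathcal{D}(\mathbb{R}^d)$.
   Context: $\mathcal{D}(\mathbb{R}^d)$ is the space of compactly supported $C^\infty$ functions, $\mathcal{D}'(\mathbb{R}^d)$ its dual (distributions). A test function $\phi$ is positive if $\phi\ge0$ everywhere and normalized if $\int_{\mathbb{R}^d}\phi=1$. The standard delta sequence generated by a normalized $\phi\in\mathcal{D}(\mathbb{R}^d)$ is $\phi_n(\mathbf{x})=n^d\phi(n\mathbf{x})$, $n=1,2,\dots$. Translations and dilations of distributions are defined by change of variables: $\langle f(\mathbf{x}_0+\varepsilon\mathbf{x}),\phi(\mathbf{x})\rangle=|\varepsilon|^{-d}\langle f(\mathbf{y}),\phi((\mathbf{y}-\mathbf{x}_0)/\varepsilon)\rangle$ for $\varepsilon\neq0$. The distributional point value $f(\mathbf{x}_0)$ (in the sense of Łojasiewicz) exists and equals $\gamma$ if $\lim_{\varepsilon\to0}\langle f(\mathbf{x}_0+\varepsilon\mathbf{x}),\phi(\mathbf{x})\rangle=\gamma\int_{\mathbb{R}^d}\phi(\mathbf{x})\,\mathrm{d}\mathbf{x}$ for all $\phi\in\mathcal{D}(\mathbb{R}^d)$.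 *)

theory Defs
  imports "HOL-Analysis.Analysis"
begin

text \<open>
  The space \<open>\<real>\<^sup>d\<close> is an arbitrary type \<open>'a\<close> of class \<open>euclidean_space\<close> with \<open>d = DIM('a)\<close>.
  Test functions and distributions are complex-valued.
\<close>

section \<open>Test functions\<close>

text \<open>
  Iterated partial derivatives, indexed by the list of the coordinate directions of
  differentiation (elements of \<open>Basis\<close>).  On smooth functions the order of the list is irrelevant,
  so such lists of length \<open>k\<close> play the role of the multi-indices of order \<open>k\<close>.
\<close>

primrec partials :: "'a::euclidean_space list \<Rightarrow> ('a \<Rightarrow> 'b::real_normed_vector) \<Rightarrow> 'a \<Rightarrow> 'b" where
  "partials [] \<phi> = \<phi>"
| "partials (b # bs) \<phi> = (\<lambda>x. frechet_derivative (partials bs \<phi>) (at x) b)"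

text \<open>
  All iterated partial derivatives exist and are continuous; the continuity is part of the
  differentiability of each of them.
\<close>

definition smooth :: "('a::euclidean_space \<Rightarrow> 'b::real_normed_vector) \<Rightarrow> bool" where
  "smooth \<phi> \<longleftrightarrow> (\<forall>bs \<in> lists Basis. \<forall>x. partials bs \<phi> differentiable (at x))"

definition test_functions :: "('a::euclidean_space \<Rightarrow> complex) set" where
  "test_functions = {\<phi>. smooth \<phi> \<and> compact (closure {x. \<phi> x \<noteq> 0})}"

definition positive_test :: "('a::euclidean_space \<Rightarrow> complex) \<Rightarrow> bool" where
  "positive_test \<phi> \<longleftrightarrow> (\<forall>x. \<phi> x \<in> \<real>\<^sub>\<ge>\<^sub>0)"

definition normalized_test :: "('a::euclidean_space \<Rightarrow> complex) \<Rightarrow> bool" where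
  "normalized_test \<phi> \<longleftrightarrow> (LINT x|lborel. \<phi> x) = 1"

section \<open>The topology of the space of test functions, and distributions\<close>

text \<open>
  For compact \<open>K\<close> these sets form a base of neighbourhoods of \<open>0\<close> in the Frechet space of test
  functions supported in \<open>K\<close> (uniform convergence of all derivatives).
\<close>

definition test_ball :: "'a::euclidean_space set \<Rightarrow> nat \<Rightarrow> real \<Rightarrow> ('a \<Rightarrow> complex) set" where
  "test_ball K N \<delta> =
     {\<phi> \<in> test_functions. {x. \<phi> x \<noteq> 0} \<subseteq> K \<and>
        (\<forall>bs \<in> lists Basis. length bs \<le> N \<longrightarrow> (\<forall>x. cmod (partials bs \<phi> x) < \<delta>))}"

text \<open>
  The usual inductive limit topology has as a base of neighbourhoods of \<open>0\<close> the absolutely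
  convex sets of test functions that, for every compact \<open>K\<close>, contain a neighbourhood of \<open>0\<close> in the
  space of test functions supported in \<open>K\<close>.
\<close>

definition zero_nbhd :: "('a::euclidean_space \<Rightarrow> complex) set \<Rightarrow> bool" where
  "zero_nbhd W \<longleftrightarrow>
     W \<subseteq> test_functions \<and>
     (\<forall>\<phi>\<in>W. \<forall>\<psi>\<in>W. \<forall>a b. cmod a + cmod b \<le> 1 \<longrightarrow> (\<lambda>x. a * \<phi> x + b * \<psi> x) \<in> W) \<and>
     (\<forall>K. compact K \<longrightarrow> (\<exists>N. \<exists>\<delta>>0. test_ball K N \<delta> \<subseteq> W))"

definition test_open :: "('a::euclidean_space \<Rightarrow> complex) set \<Rightarrow> bool" where
  "test_open U \<longleftrightarrow> U \<subseteq> test_functions \<and>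
     (\<forall>\<phi>\<in>U. \<exists>W. zero_nbhd W \<and> (\<forall>\<psi>\<in>W. (\<lambda>x. \<phi> x + \<psi> x) \<in> U))"

definition test_topology :: "('a::euclidean_space \<Rightarrow> complex) topology" where
  "test_topology = topology test_open"

lemma test_ball_mono: "N' \<le> N \<Longrightarrow> \<delta> \<le> \<delta>' \<Longrightarrow> test_ball K N \<delta> \<subseteq> test_ball K N' \<delta>'"
  unfolding test_ball_def by (smt (verit) Collect_mono order_trans)

lemma zero_nbhd_Int:
  assumes "zero_nbhd V" "zero_nbhd W"
  shows "zero_nbhd (V \<inter> W)"
  unfolding zero_nbhd_def
proof (intro conjI allI impI)
  show "V \<inter> W \<subseteq> test_functions"
    using assms by (auto simp: zero_nbhd_def)
  show "\<forall>\<phi>\<in>V \<inter> W. \<forall>\<psi>\<in>V \<inter> W. \<forall>a b. cmod a + cmod b \<le> 1 \<longrightarrow>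
          (\<lambda>x. a * \<phi> x + b * \<psi> x) \<in> V \<inter> W"
    using assms by (auto simp: zero_nbhd_def)
next
  fix K :: "'a set"
  assume K: "compact K"
  obtain N1 \<delta>1 where 1: "\<delta>1 > 0" "test_ball K N1 \<delta>1 \<subseteq> V"
    using assms(1) K unfolding zero_nbhd_def by meson
  obtain N2 \<delta>2 where 2: "\<delta>2 > 0" "test_ball K N2 \<delta>2 \<subseteq> W"
    using assms(2) K unfolding zero_nbhd_def by meson
  have "test_ball K (max N1 N2) (min \<delta>1 \<delta>2) \<subseteq> test_ball K N1 \<delta>1"
    "test_ball K (max N1 N2) (min \<delta>1 \<delta>2) \<subseteq> test_ball K N2 \<delta>2"
    by (simp_all only: test_ball_mono max.cobounded1 max.cobounded2 min.cobounded1 min.cobounded2)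
  then have "test_ball K (max N1 N2) (min \<delta>1 \<delta>2) \<subseteq> V \<inter> W"
    using 1(2) 2(2) by (blast dest: order_trans)
  moreover have "min \<delta>1 \<delta>2 > 0"
    using 1(1) 2(1) by simp
  ultimately show "\<exists>N. \<exists>\<delta>>0. test_ball K N \<delta> \<subseteq> V \<inter> W"
    by (intro exI conjI)
qed

lemma istopology_test_open: "istopology test_open"
  unfolding istopology_def
proof (intro conjI allI impI)
  fix S T :: "('a \<Rightarrow> complex) set"
  assume S: "test_open S" and T: "test_open T"
  show "test_open (S \<inter> T)"
    unfolding test_open_def
  proof (intro conjI ballI)
    show "S \<inter> T \<subseteq> test_functions"
      using S by (auto simp: test_open_def)
  next
    fix \<phi> assume "\<phi> \<in> S \<inter> T"
    then obtain V W where "zero_nbhd V" "\<forall>\<psi>\<in>V. (\<lambda>x. \<phi> x + \<psi> x) \<in> S"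
      "zero_nbhd W" "\<forall>\<psi>\<in>W. (\<lambda>x. \<phi> x + \<psi> x) \<in> T"
      using S T unfolding test_open_def by blast
    then show "\<exists>W. zero_nbhd W \<and> (\<forall>\<psi>\<in>W. (\<lambda>x. \<phi> x + \<psi> x) \<in> S \<inter> T)"
      by (intro exI[of _ "V \<inter> W"]) (auto intro: zero_nbhd_Int)
  qed
next
  fix \<K> :: "('a \<Rightarrow> complex) set set"
  assume \<K>: "\<forall>U\<in>\<K>. test_open U"
  then show "test_open (\<Union>\<K>)"
    unfolding test_open_def
  proof (intro conjI ballI)
    fix \<phi> assume "\<phi> \<in> \<Union>\<K>"
    then obtain U where "U \<in> \<K>" "\<phi> \<in> U" by blast
    moreover from this obtain W where "zero_nbhd W" "\<forall>\<psi>\<in>W. (\<lambda>x. \<phi> x + \<psi> x) \<in> U"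
      using \<K> unfolding test_open_def by blast
    ultimately show "\<exists>W. zero_nbhd W \<and> (\<forall>\<psi>\<in>W. (\<lambda>x. \<phi> x + \<psi> x) \<in> \<Union>\<K>)"
      by blast
  next
    show "\<Union>\<K> \<subseteq> test_functions"
      using \<K> by (auto simp: test_open_def)
  qed
qed

lemma openin_test_topology: "openin test_topology U \<longleftrightarrow> test_open U"
  by (simp add: test_topology_def istopology_test_open topology_inverse')

lemma partials_add:
  assumes "smooth \<phi>" "smooth \<psi>" "bs \<in> lists Basis"
  shows "partials bs (\<lambda>x. \<phi> x + \<psi> x) = (\<lambda>x. partials bs \<phi> x + partials bs \<psi> x)"
  using assms(3)
proof (induction bs)
  case Nil
  then show ?case by simp
next
  case (Cons b bs)
  then have "partials bs \<phi> differentiable (at x)" "partials bs \<psi> differentiable (at x)" for x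
    using assms(1,2) by (auto simp: smooth_def)
  then have "frechet_derivative (\<lambda>x. partials bs \<phi> x + partials bs \<psi> x) (at x) =
      (\<lambda>v. frechet_derivative (partials bs \<phi>) (at x) v + frechet_derivative (partials bs \<psi>) (at x) v)" for x
    by (intro frechet_derivative_at[symmetric] has_derivative_add)
       (simp_all add: frechet_derivative_works[symmetric])
  with Cons show ?case by auto
qed

lemma test_functions_add:
  assumes "\<phi> \<in> test_functions" "\<psi> \<in> test_functions"
  shows "(\<lambda>x. \<phi> x + \<psi> x) \<in> test_functions"
proof -
  have sm: "smooth \<phi>" "smooth \<psi>"
    using assms by (auto simp: test_functions_def)
  then have "smooth (\<lambda>x. \<phi> x + \<psi> x)"
    using partials_add[OF sm] by (auto simp: smooth_def intro!: differentiable_add)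
  moreover have "compact (closure {x. \<phi> x + \<psi> x \<noteq> 0})"
  proof (rule compact_closure[THEN iffD2], rule bounded_subset)
    show "bounded ({x. \<phi> x \<noteq> 0} \<union> {x. \<psi> x \<noteq> 0})"
      using assms by (simp add: test_functions_def)
  qed auto
  ultimately show ?thesis
    by (simp add: test_functions_def)
qed

lemma partials_cmult:
  fixes \<phi> :: "'a::euclidean_space \<Rightarrow> complex"
  assumes "smooth \<phi>" "bs \<in> lists Basis"
  shows "partials bs (\<lambda>x. c * \<phi> x) = (\<lambda>x. c * partials bs \<phi> x)"
  using assms(2)
proof (induction bs)
  case Nil
  then show ?case by simp
next
  case (Cons b bs)
  then have "partials bs \<phi> differentiable (at x)" for x
    using assms(1) by (auto simp: smooth_def)
  then have "frechet_derivative (\<lambda>x. c * partials bs \<phi> x) (at x) =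
      (\<lambda>v. c * frechet_derivative (partials bs \<phi>) (at x) v)" for x
    by (intro frechet_derivative_at[symmetric] has_derivative_mult_right)
       (simp_all add: frechet_derivative_works[symmetric])
  with Cons show ?case by auto
qed

lemma test_functions_cmult:
  assumes "\<phi> \<in> test_functions"
  shows "(\<lambda>x. c * \<phi> x) \<in> test_functions"
proof -
  have sm: "smooth \<phi>"
    using assms by (auto simp: test_functions_def)
  then have "smooth (\<lambda>x. c * \<phi> x)"
    using partials_cmult[OF sm] by (auto simp: smooth_def intro!: differentiable_mult)
  moreover have "compact (closure {x. c * \<phi> x \<noteq> 0})"
  proof (rule compact_closure[THEN iffD2], rule bounded_subset)
    show "bounded {x. \<phi> x \<noteq> 0}"
      using assms by (simp add: test_functions_def)
  qed auto
  ultimately show ?thesis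
    by (simp add: test_functions_def)
qed

lemma topspace_test_topology:
  "topspace test_topology = (test_functions :: ('a::euclidean_space \<Rightarrow> complex) set)"
proof -
  have "zero_nbhd (test_functions :: ('a \<Rightarrow> complex) set)"
    unfolding zero_nbhd_def
  proof (intro conjI ballI allI impI)
    show "\<exists>N. \<exists>\<delta>>0. test_ball K N \<delta> \<subseteq> test_functions" for K :: "'a set"
      by (intro exI[of _ "1::real"] exI[of _ "0::nat"]) (auto simp: test_ball_def)
  qed (simp_all add: test_functions_add test_functions_cmult)
  then have "test_open (test_functions :: ('a \<Rightarrow> complex) set)"
    unfolding test_open_def
    by (intro conjI ballI exI[of _ "test_functions :: ('a \<Rightarrow> complex) set"])
       (simp_all add: test_functions_add)
  moreover have "test_open (topspace test_topology :: ('a \<Rightarrow> complex) set)"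
    by (metis openin_test_topology openin_topspace)
  then have "topspace test_topology \<subseteq> (test_functions :: ('a \<Rightarrow> complex) set)"
    unfolding test_open_def by (rule conjunct1)
  ultimately show ?thesis
    by (metis openin_subset openin_test_topology subset_antisym)
qed

text \<open>
  Only the values on \<open>test_functions\<close> of a functional \<open>f\<close> are relevant: \<open>f \<phi>\<close> is the pairing of
  \<open>f\<close> with the test function \<open>\<phi>\<close>.
\<close>

definition distribution :: "(('a::euclidean_space \<Rightarrow> complex) \<Rightarrow> complex) \<Rightarrow> bool" where
  "distribution f \<longleftrightarrow>
     (\<forall>\<phi>\<in>test_functions. \<forall>\<psi>\<in>test_functions. f (\<lambda>x. \<phi> x + \<psi> x) = f \<phi> + f \<psi>) \<and>
     (\<forall>c. \<forall>\<phi>\<in>test_functions. f (\<lambda>x. c * \<phi> x) = c * f \<phi>) \<and>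
     continuous_map test_topology euclidean f"

section \<open>Point values and delta sequences\<close>

text \<open>The functional written \<open>f(x\<^sub>0 + \<epsilon>x)\<close>, defined by change of variables for \<open>\<epsilon> \<noteq> 0\<close>.\<close>

definition shift_dilate ::
  "(('a::euclidean_space \<Rightarrow> complex) \<Rightarrow> complex) \<Rightarrow> 'a \<Rightarrow> real \<Rightarrow> ('a \<Rightarrow> complex) \<Rightarrow> complex" where
  "shift_dilate f x\<^sub>0 \<epsilon> \<phi> =
     complex_of_real (inverse (\<bar>\<epsilon>\<bar> ^ DIM('a))) * f (\<lambda>y. \<phi> ((y - x\<^sub>0) /\<^sub>R \<epsilon>))"

text \<open>
  The point value of \<open>f\<close> at \<open>x\<^sub>0\<close> in the sense of Lojasiewicz exists and equals \<open>\<gamma>\<close>; the limit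
  \<open>\<epsilon> \<rightarrow> 0\<close> is two-sided.
\<close>

definition has_point_value ::
  "(('a::euclidean_space \<Rightarrow> complex) \<Rightarrow> complex) \<Rightarrow> 'a \<Rightarrow> complex \<Rightarrow> bool" where
  "has_point_value f x\<^sub>0 \<gamma> \<longleftrightarrow>
     (\<forall>\<phi>\<in>test_functions.
        ((\<lambda>\<epsilon>. shift_dilate f x\<^sub>0 \<epsilon> \<phi>) \<longlongrightarrow> \<gamma> * (LINT x|lborel. \<phi> x)) (at 0))"

text \<open>Delta sequences start at \<open>n = 1\<close>; the term \<open>n = 0\<close> is an artefact of the indexing.\<close>

definition standard_delta_seq ::
  "('a::euclidean_space \<Rightarrow> complex) \<Rightarrow> nat \<Rightarrow> 'a \<Rightarrow> complex" where
  "standard_delta_seq \<phi> n = (\<lambda>x. of_nat n ^ DIM('a) * \<phi> (real n *\<^sub>R x))"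

end

theory Submission
  imports Defs
begin

text \<open>
  Write \<open>L\<^sub>n \<phi>\<close> for \<open>\<langle>f(x\<^sub>0 + x/n), \<phi>(x)\<rangle>\<close>, the pairing of \<open>f(x\<^sub>0 + x)\<close> with \<open>\<phi>\<^sub>n\<close>. The
  convergence of \<open>L\<^sub>n \<phi>\<close> for positive normalized \<open>\<phi>\<close> extends to all test functions, since every
  real test function is a difference of two positive ones. For \<open>0 < \<epsilon> \<le> 1\<close> write
  \<open>1/\<epsilon> = c n\<close> with \<open>n = \<lfloor>1/\<epsilon>\<rfloor>\<close>; then \<open>c \<rightarrow> 1\<close> as \<open>\<epsilon> \<rightarrow> 0\<close>, and the pairing of \<open>f(x\<^sub>0 + \<epsilon>x)\<close>
  with \<open>\<phi>\<close> is \<open>c\<^sup>d L\<^sub>n(\<phi>(c x))\<close>. As \<open>\<phi>(c x) - \<phi>(x)\<close> tends to \<open>0\<close> in the space of test functions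
  and the pointwise convergent sequence \<open>L\<^sub>n\<close> is equicontinuous there, the limit along \<open>1/n\<close> is the
  limit along \<open>\<epsilon> \<rightarrow> 0+\<close>. Negative \<open>\<epsilon>\<close> are reduced to positive ones by reflecting \<open>\<phi>\<close>.
\<close>

section \<open>Closure properties of smooth functions\<close>

lemma partials_append: "partials (bs @ cs) \<phi> = partials bs (partials cs \<phi>)"
  by (induction bs) simp_all

lemma partials_bounded_linear:
  assumes "bounded_linear T" "smooth \<phi>" "bs \<in> lists Basis"
  shows "partials bs (\<lambda>x. T (\<phi> x)) = (\<lambda>x. T (partials bs \<phi> x))"
  using assms(3)
proof (induction bs)
  case Nil
  then show ?case by simp
next
  case (Cons b bs)
  then have "partials bs \<phi> differentiable (at x)" for x
    using assms(2) by (auto simp: smooth_def)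
  then have "frechet_derivative (\<lambda>x. T (partials bs \<phi> x)) (at x) =
      (\<lambda>v. T (frechet_derivative (partials bs \<phi>) (at x) v))" for x
    by (intro frechet_derivative_at[symmetric] bounded_linear.has_derivative[OF assms(1)])
       (simp_all add: frechet_derivative_works[symmetric])
  with Cons show ?case by auto
qed

lemma smooth_bounded_linear:
  fixes \<phi> :: "'a::euclidean_space \<Rightarrow> 'b::real_normed_vector"
  assumes "bounded_linear T" "smooth \<phi>"
  shows "smooth (\<lambda>x. T (\<phi> x))"
  unfolding smooth_def
proof (intro ballI allI)
  fix bs :: "'a list" and x assume bs: "bs \<in> lists Basis"
  then have "partials bs \<phi> differentiable (at x)"
    using assms(2) by (auto simp: smooth_def)
  then show "partials bs (\<lambda>x. T (\<phi> x)) differentiable (at x)"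
    unfolding partials_bounded_linear[OF assms bs] differentiable_def
    using bounded_linear.has_derivative[OF assms(1)] by blast
qed

text \<open>By the chain rule each differentiation brings out one factor \<open>c\<close>. The
  directions do not change, because the linear part of the inner map is a multiple of the
  identity.\<close>

lemma partials_affine:
  assumes "smooth \<phi>" "bs \<in> lists Basis"
  shows "partials bs (\<lambda>x. \<phi> (c *\<^sub>R x + a)) = (\<lambda>x. c ^ length bs *\<^sub>R partials bs \<phi> (c *\<^sub>R x + a))"
  using assms(2)
proof (induction bs)
  case Nil
  then show ?case by simp
next
  case (Cons b bs)
  then have d: "partials bs \<phi> differentiable (at x)" for x
    using assms(1) by (auto simp: smooth_def)
  have "((\<lambda>x. c ^ length bs *\<^sub>R partials bs \<phi> (c *\<^sub>R x + a)) has_derivative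
      (\<lambda>v. c ^ length bs *\<^sub>R frechet_derivative (partials bs \<phi>) (at (c *\<^sub>R x + a)) (c *\<^sub>R v))) (at x)" for x
    by (intro has_derivative_scaleR_right
          has_derivative_compose[of "\<lambda>x. c *\<^sub>R x + a" "\<lambda>v. c *\<^sub>R v" _ _ "partials bs \<phi>"])
       (auto intro!: derivative_eq_intros d[unfolded frechet_derivative_works])
  then have "frechet_derivative (\<lambda>x. c ^ length bs *\<^sub>R partials bs \<phi> (c *\<^sub>R x + a)) (at x) =
      (\<lambda>v. c ^ length bs *\<^sub>R frechet_derivative (partials bs \<phi>) (at (c *\<^sub>R x + a)) (c *\<^sub>R v))" for x
    by (intro frechet_derivative_at[symmetric])
  moreover have "frechet_derivative (partials bs \<phi>) (at y) (c *\<^sub>R v) =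
      c *\<^sub>R frechet_derivative (partials bs \<phi>) (at y) v" for y v
    by (rule linear_cmul[OF linear_frechet_derivative[OF d]])
  ultimately show ?case
    using Cons by (auto simp: mult.commute)
qed

lemma smooth_affine:
  assumes "smooth \<phi>"
  shows "smooth (\<lambda>x. \<phi> (c *\<^sub>R x + a))"
  unfolding smooth_def
proof (intro ballI allI)
  fix bs :: "'a list" and x assume bs: "bs \<in> lists Basis"
  then have "partials bs \<phi> differentiable (at y)" for y
    using assms by (auto simp: smooth_def)
  then have "(partials bs \<phi> \<circ> (\<lambda>x. c *\<^sub>R x + a)) differentiable (at x)"
    by (intro differentiable_chain_at) (auto intro!: derivative_intros)
  then show "partials bs (\<lambda>x. \<phi> (c *\<^sub>R x + a)) differentiable (at x)"
    unfolding partials_affine[OF assms bs] o_def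
    by (intro differentiable_scaleR differentiable_const)
qed

text \<open>Instead of a Leibniz formula for a whole list of directions, the induction runs over the
  order of differentiability. One application of the product rule leaves a sum of two products, and
  their factors satisfy the hypothesis of the next lower order.\<close>

lemma smooth_mult:
  fixes \<phi> \<psi> :: "'a::euclidean_space \<Rightarrow> 'b::real_normed_algebra"
  assumes "smooth \<phi>" "smooth \<psi>"
  shows "smooth (\<lambda>x. \<phi> x * \<psi> x)"
proof -
  \<comment> \<open>The product rule has to act on the derivative taken first, which is the last
    entry of the list, while \<open>partials\<close> recurses on the one taken last.
    \<open>CSuc\<close> and \<open>CSucI\<close> turn this recursion around.\<close>
  define C where "C n \<phi> \<longleftrightarrow> (\<forall>bs\<in>lists Basis. length bs \<le> n \<longrightarrow> (\<forall>x. partials bs \<phi> differentiable (at x)))"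
    for n and \<phi> :: "'a \<Rightarrow> 'b"
  have C0: "\<phi> differentiable (at x)" if "C n \<phi>" for n \<phi> x
    using that unfolding C_def by (auto dest!: bspec[of _ _ "[]"])
  have CSuc: "C n (\<lambda>x. frechet_derivative \<phi> (at x) b)" if "C (Suc n) \<phi>" "b \<in> Basis" for n \<phi> b
    unfolding C_def
  proof (intro ballI impI allI)
    fix bs :: "'a list" and x assume "bs \<in> lists Basis" "length bs \<le> n"
    then have "partials (bs @ [b]) \<phi> differentiable (at x)"
      using that unfolding C_def by (intro that(1)[unfolded C_def, rule_format]) auto
    then show "partials bs (\<lambda>x. frechet_derivative \<phi> (at x) b) differentiable (at x)"
      by (simp add: partials_append)
  qed
  have CSucI: "C (Suc n) \<phi>"
    if "\<And>x. \<phi> differentiable (at x)" "\<And>b. b \<in> Basis \<Longrightarrow> C n (\<lambda>x. frechet_derivative \<phi> (at x) b)" for n \<phi>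
    unfolding C_def
  proof (intro ballI impI allI)
    fix bs :: "'a list" and x assume bs: "bs \<in> lists Basis" "length bs \<le> Suc n"
    show "partials bs \<phi> differentiable (at x)"
    proof (cases bs rule: rev_cases)
      case Nil
      then show ?thesis by (simp add: that)
    next
      case (snoc cs b)
      then show ?thesis
        using bs that(2)[of b] by (simp add: partials_append C_def)
    qed
  qed
  have Cmono: "C n \<phi>" if "C (Suc n) \<phi>" for n \<phi>
    using that by (auto simp: C_def)
  have Cadd: "C n (\<lambda>x. \<phi> x + \<psi> x)" if "C n \<phi>" "C n \<psi>" for n \<phi> \<psi>
    using that
  proof (induction n arbitrary: \<phi> \<psi>)
    case 0
    then show ?case by (auto simp: C_def intro!: differentiable_add dest!: bspec[of _ _ "[]"])
  next
    case (Suc n)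
    note d = C0[OF Suc.prems(1)] C0[OF Suc.prems(2)]
    have "frechet_derivative (\<lambda>x. \<phi> x + \<psi> x) (at x) =
        (\<lambda>v. frechet_derivative \<phi> (at x) v + frechet_derivative \<psi> (at x) v)" for x
      using d by (intro frechet_derivative_at[symmetric] has_derivative_add)
         (simp_all add: frechet_derivative_works[symmetric])
    then show ?case
      using Suc.prems by (intro CSucI) (auto intro!: differentiable_add d Suc.IH CSuc)
  qed
  have "C n (\<lambda>x. \<phi> x * \<psi> x)" if "C n \<phi>" "C n \<psi>" for n \<phi> \<psi>
    using that
  proof (induction n arbitrary: \<phi> \<psi>)
    case 0
    then show ?case by (auto simp: C_def intro!: differentiable_mult dest!: bspec[of _ _ "[]"])
  next
    case (Suc n)
    note d = C0[OF Suc.prems(1)] C0[OF Suc.prems(2)]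
    have "frechet_derivative (\<lambda>x. \<phi> x * \<psi> x) (at x) =
        (\<lambda>v. \<phi> x * frechet_derivative \<psi> (at x) v + frechet_derivative \<phi> (at x) v * \<psi> x)" for x
      using d by (intro frechet_derivative_at[symmetric] has_derivative_mult)
         (simp_all add: frechet_derivative_works[symmetric])
    then show ?case
      using Suc.prems by (intro CSucI) (auto intro!: differentiable_mult d Cadd Suc.IH CSuc intro: Cmono)
  qed
  then show ?thesis
    using assms unfolding smooth_def C_def by blast
qed

section \<open>Locality of differentiation\<close>

lemma partials_eq_0_on_open:
  assumes "open U" "\<And>x. x \<in> U \<Longrightarrow> \<phi> x = 0" "x \<in> U"
  shows "partials bs \<phi> x = 0"
  using assms(3)
proof (induction bs arbitrary: x)
  case Nil
  then show ?case by (simp add: assms(2))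
next
  case (Cons b bs)
  have "(partials bs \<phi> has_derivative (\<lambda>_. 0)) (at x)"
    by (rule has_derivative_transform_within_open[OF has_derivative_const assms(1) Cons.prems])
       (simp add: Cons.IH)
  then show ?case
    by (simp add: frechet_derivative_at[symmetric])
qed

text \<open>The complement of a closed set is open, so differentiation sees only zeros there: no
  derivative enlarges the support beyond \<open>K\<close>.\<close>

lemma partials_eq_0_outside:
  assumes "closed K" "{x. \<phi> x \<noteq> 0} \<subseteq> K" "x \<notin> K"
  shows "partials bs \<phi> x = 0"
  using assms by (intro partials_eq_0_on_open[of "- K"]) auto

section \<open>Test functions\<close>

lemma test_functions_iff: "\<phi> \<in> test_functions \<longleftrightarrow> smooth \<phi> \<and> bounded {x. \<phi> x \<noteq> 0}"
  by (simp add: test_functions_def)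

lemma test_functions_0: "(\<lambda>x. 0) \<in> test_functions"
proof -
  have "partials bs (\<lambda>x::'a. 0 :: complex) = (\<lambda>x. 0)" for bs
    using partials_eq_0_on_open[of UNIV "\<lambda>x::'a. 0 :: complex"] by auto
  then show ?thesis
    by (simp add: test_functions_iff smooth_def)
qed

lemma test_functions_minus: "\<phi> \<in> test_functions \<Longrightarrow> (\<lambda>x. - \<phi> x) \<in> test_functions"
  using test_functions_cmult[of \<phi> "-1"] by simp

lemma test_functions_diff:
  "\<phi> \<in> test_functions \<Longrightarrow> \<psi> \<in> test_functions \<Longrightarrow> (\<lambda>x. \<phi> x - \<psi> x) \<in> test_functions"
  using test_functions_add[OF _ test_functions_minus, of \<phi> \<psi>] by simp

lemma partials_diff:
  fixes \<phi> \<psi> :: "'a::euclidean_space \<Rightarrow> complex"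
  assumes "\<phi> \<in> test_functions" "\<psi> \<in> test_functions" "bs \<in> lists Basis"
  shows "partials bs (\<lambda>x. \<phi> x - \<psi> x) = (\<lambda>x. partials bs \<phi> x - partials bs \<psi> x)"
  using partials_add[of \<phi> "\<lambda>x. - 1 * \<psi> x" bs] partials_cmult[of \<psi> bs "- 1"]
    test_functions_minus[OF assms(2)] assms
  by (simp add: test_functions_iff)

lemma test_functions_sum:
  "finite A \<Longrightarrow> (\<And>i. i \<in> A \<Longrightarrow> g i \<in> test_functions) \<Longrightarrow> (\<lambda>x. \<Sum>i\<in>A. g i x) \<in> test_functions"
  by (induction A rule: finite_induct) (simp_all add: test_functions_0 test_functions_add)

lemma partials_sum:
  fixes g :: "'i \<Rightarrow> 'a::euclidean_space \<Rightarrow> complex"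
  assumes "finite A" "\<And>i. i \<in> A \<Longrightarrow> g i \<in> test_functions" "bs \<in> lists Basis"
  shows "partials bs (\<lambda>x. \<Sum>i\<in>A. g i x) = (\<lambda>x. \<Sum>i\<in>A. partials bs (g i) x)"
  using assms
proof (induction A rule: finite_induct)
  case empty
  then show ?case
    using partials_eq_0_on_open[of UNIV "\<lambda>x::'a. 0 :: complex"] by auto
next
  case (insert i A)
  then have "smooth (g i)" "smooth (\<lambda>x. \<Sum>i\<in>A. g i x)"
    using test_functions_sum[of A g] by (auto simp: test_functions_iff)
  with insert show ?case
    by (simp add: partials_add)
qed

lemma test_functions_mult:
  "\<phi> \<in> test_functions \<Longrightarrow> \<psi> \<in> test_functions \<Longrightarrow> (\<lambda>x. \<phi> x * \<psi> x) \<in> test_functions"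
  unfolding test_functions_iff by (auto intro: smooth_mult bounded_subset)

lemma test_functions_affine:
  assumes "\<phi> \<in> test_functions" "c \<noteq> 0"
  shows "(\<lambda>x. \<phi> (c *\<^sub>R x + a)) \<in> test_functions"
proof -
  have "{x. \<phi> (c *\<^sub>R x + a) \<noteq> 0} \<subseteq> (\<lambda>y. (1 / c) *\<^sub>R y + (- (1 / c) *\<^sub>R a)) ` {x. \<phi> x \<noteq> 0}"
  proof
    fix x assume "x \<in> {x. \<phi> (c *\<^sub>R x + a) \<noteq> 0}"
    then show "x \<in> (\<lambda>y. (1 / c) *\<^sub>R y + (- (1 / c) *\<^sub>R a)) ` {x. \<phi> x \<noteq> 0}"
      using assms(2) by (intro image_eqI[of _ _ "c *\<^sub>R x + a"]) (auto simp: algebra_simps)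
  qed
  moreover have "bounded ((\<lambda>y. (1 / c) *\<^sub>R y + (- (1 / c) *\<^sub>R a)) ` {x. \<phi> x \<noteq> 0})"
    using assms(1) bounded_translation[OF bounded_scaling, of "{x. \<phi> x \<noteq> 0}" "- (1/c) *\<^sub>R a" "1/c"]
    by (simp add: test_functions_iff image_image add.commute)
  ultimately show ?thesis
    using assms by (auto simp: test_functions_iff intro: smooth_affine bounded_subset)
qed

text \<open>\<open>T\<close> is only real-linear, so that the real and imaginary parts of a test
  function are covered.\<close>

lemma test_functions_bounded_linear:
  assumes "bounded_linear T" "\<phi> \<in> test_functions"
  shows "(\<lambda>x. T (\<phi> x)) \<in> test_functions"
proof -
  interpret T: bounded_linear T by fact
  have "{x. T (\<phi> x) \<noteq> 0} \<subseteq> {x. \<phi> x \<noteq> 0}"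
    by (auto simp: T.zero)
  moreover have "smooth \<phi>" "bounded {x. \<phi> x \<noteq> 0}"
    using assms(2) by (simp_all add: test_functions_iff)
  ultimately show ?thesis
    unfolding test_functions_iff using assms(1) smooth_bounded_linear bounded_subset by blast
qed

section \<open>Continuity, boundedness and integrals of test functions\<close>

lemma continuous_partials:
  "\<phi> \<in> test_functions \<Longrightarrow> bs \<in> lists Basis \<Longrightarrow> continuous_on S (partials bs \<phi>)"
  by (intro differentiable_imp_continuous_on)
     (auto simp: test_functions_iff smooth_def differentiable_on_def intro: differentiable_at_withinI)

lemma continuous_test: "\<phi> \<in> test_functions \<Longrightarrow> continuous_on S \<phi>"
  using continuous_partials[of \<phi> "[]"] by simp

lemma test_supported_in_cball:
  assumes "\<phi> \<in> test_functions"
  obtains R where "R > 0" "{x. \<phi> x \<noteq> 0} \<subseteq> cball 0 R"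
  using assms unfolding test_functions_iff bounded_pos by (auto simp: subset_iff)

text \<open>Continuity on a compact ball containing the support gives the bound there; off that ball
  the derivative is 0.\<close>

lemma bounded_partials:
  assumes "\<phi> \<in> test_functions" "bs \<in> lists Basis"
  obtains B where "B > 0" "\<And>x. cmod (partials bs \<phi> x) \<le> B"
proof -
  obtain R where R: "{x. \<phi> x \<noteq> 0} \<subseteq> cball 0 R"
    using test_supported_in_cball[OF assms(1)] by blast
  have "compact (partials bs \<phi> ` cball 0 R)"
    by (intro compact_continuous_image continuous_partials assms compact_cball)
  then have "bounded (partials bs \<phi> ` cball 0 R)"
    by (rule compact_imp_bounded)
  then obtain B where B: "B > 0" "\<And>x. x \<in> cball 0 R \<Longrightarrow> cmod (partials bs \<phi> x) \<le> B"
    unfolding bounded_pos by auto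
  have "cmod (partials bs \<phi> x) \<le> B" for x
  proof (cases "x \<in> cball 0 R")
    case False
    then show ?thesis
      using partials_eq_0_outside[OF closed_cball R False, of bs] B(1) by simp
  qed (fact B(2))
  with B(1) show thesis
    by (rule that)
qed

lemma integrable_test:
  assumes "\<phi> \<in> test_functions"
  shows "integrable lborel \<phi>"
proof -
  have "integrable lborel (\<lambda>x. indicator (closure {x. \<phi> x \<noteq> 0}) x *\<^sub>R \<phi> x)"
    using assms by (intro borel_integrable_compact continuous_test) (auto simp: test_functions_def)
  also have "(\<lambda>x. indicator (closure {x. \<phi> x \<noteq> 0}) x *\<^sub>R \<phi> x) = \<phi>"
    using closure_subset[of "{x. \<phi> x \<noteq> 0}"] by (intro ext) (auto simp: indicator_def)
  finally show ?thesis .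
qed

text \<open>Lebesgue measure is its own image under the dilation, weighted by the density
  \<open>\<bar>c\<bar> ^ DIM('a)\<close>. The absolute value admits negative \<open>c\<close>, in
  particular the reflection.\<close>

lemma integral_dilation:
  fixes \<phi> :: "'a::euclidean_space \<Rightarrow> complex"
  assumes "\<phi> \<in> test_functions" "c \<noteq> 0"
  shows "(LINT x|lborel. \<phi> (c *\<^sub>R x)) = of_real (inverse (\<bar>c\<bar> ^ DIM('a))) * (LINT x|lborel. \<phi> x)"
proof -
  have [measurable]: "\<phi> \<in> borel_measurable borel"
    by (intro borel_measurable_continuous_onI continuous_test assms)
  have "(LINT x|lborel. \<phi> x) = (LINT x|density (distr lborel borel (\<lambda>x. 0 + c *\<^sub>R x)) (\<lambda>_. ennreal (\<bar>c\<bar> ^ DIM('a))). \<phi> x)"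
    by (rule arg_cong[of _ _ "\<lambda>M. integral\<^sup>L M \<phi>"]) (rule lborel_affine[OF assms(2)])
  also have "\<dots> = (LINT x|lborel. \<bar>c\<bar> ^ DIM('a) *\<^sub>R \<phi> (c *\<^sub>R x))"
    by (subst integral_density) (auto simp: integral_distr)
  also have "\<dots> = of_real (\<bar>c\<bar> ^ DIM('a)) * (LINT x|lborel. \<phi> (c *\<^sub>R x))"
    by (simp add: scaleR_conv_of_real)
  finally show ?thesis
    using assms(2) by simp
qed

text \<open>A nonnegative function with integral 0 vanishes almost everywhere, so its set of
  nonzeros is an open null set and hence empty. This settles the positive test functions that cannot
  be normalized.\<close>

lemma test_nonneg_integral_0:
  assumes "\<phi> \<in> test_functions" "positive_test \<phi>" "(LINT x|lborel. \<phi> x) = 0"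
  shows "\<phi> x = 0"
proof -
  have pos: "0 \<le> Re (\<phi> x)" "Im (\<phi> x) = 0" for x
    using assms(2) by (auto simp: positive_test_def nonneg_Reals_def complex_eq_iff)
  have "(LINT x|lborel. Re (\<phi> x)) = 0"
    using integral_Re[OF integrable_test[OF assms(1)]] assms(3) by simp
  then have "AE x in lborel. Re (\<phi> x) = 0"
    using integral_nonneg_eq_0_iff_AE[of lborel "\<lambda>x. Re (\<phi> x)"] integrable_test[OF assms(1)] pos by auto
  then have "AE x in lborel. \<phi> x = 0"
    by (elim AE_mp) (auto simp: complex_eq_iff pos)
  moreover have op: "open {x. \<phi> x \<noteq> 0}"
    using continuous_test[OF assms(1), of UNIV] by (intro open_Collect_neq) auto
  ultimately have "{x. \<phi> x \<noteq> 0} \<in> null_sets lborel"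
    by (auto simp: AE_iff_null)
  then have "negligible {x. \<phi> x \<noteq> 0}"
    by (auto simp: negligible_iff_null_sets intro: null_sets_completionI)
  then have "{x. \<phi> x \<noteq> 0} = {}"
    using op open_not_negligible by blast
  then show ?thesis by auto
qed

section \<open>Null sequences of test functions\<close>

text \<open>For compact \<open>K\<close> this is convergence to 0 in the Frechet space of test
  functions supported in \<open>K\<close>. Continuity of functionals is used only along such
  sequences once \<open>distribution_test_null_seq\<close> is available.\<close>

definition test_null_seq :: "'a::euclidean_space set \<Rightarrow> (nat \<Rightarrow> 'a \<Rightarrow> complex) \<Rightarrow> bool" where
  "test_null_seq K g \<longleftrightarrow> (\<forall>n. g n \<in> test_functions \<and> {x. g n x \<noteq> 0} \<subseteq> K) \<and>
     (\<forall>bs\<in>lists Basis. uniform_limit UNIV (\<lambda>n. partials bs (g n)) (\<lambda>_. 0) sequentially)"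

text \<open>\<open>Basis\<close> is finite, so only finitely many lists have length at most
  \<open>N\<close>, and their uniform estimates hold simultaneously from some index on.\<close>

lemma test_null_seq_eventually_ball:
  fixes g :: "nat \<Rightarrow> 'a::euclidean_space \<Rightarrow> complex"
  assumes "test_null_seq K g" "\<delta> > 0"
  shows "\<forall>\<^sub>F n in sequentially. g n \<in> test_ball K N \<delta>"
proof -
  have "finite {bs::'a list. set bs \<subseteq> Basis \<and> length bs \<le> N}"
    by (intro finite_lists_length_le finite_Basis)
  moreover have "\<forall>\<^sub>F n in sequentially. \<forall>x. cmod (partials bs (g n) x) < \<delta>" if "bs \<in> lists Basis" for bs
    using assms that unfolding test_null_seq_def uniform_limit_iff by simp
  ultimately have "\<forall>\<^sub>F n in sequentially. \<forall>bs\<in>{bs. set bs \<subseteq> Basis \<and> length bs \<le> N}.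
      \<forall>x. cmod (partials bs (g n) x) < \<delta>"
    by (intro eventually_ball_finite) auto
  then show ?thesis
  proof eventually_elim
    case (elim n)
    then show ?case
      using assms(1) unfolding test_ball_def test_null_seq_def by (simp add: lists_eq_set)
  qed
qed

section \<open>Series of test functions and the gliding hump\<close>

lemma frechet_derivative_Basis:
  assumes "f differentiable (at x)"
  shows "frechet_derivative f (at x) h = (\<Sum>b\<in>Basis. (h \<bullet> b) *\<^sub>R frechet_derivative f (at x) b)"
proof -
  interpret linear "frechet_derivative f (at x)"
    by (rule linear_frechet_derivative[OF assms])
  have "frechet_derivative f (at x) (\<Sum>b\<in>Basis. (h \<bullet> b) *\<^sub>R b) =
      (\<Sum>b\<in>Basis. (h \<bullet> b) *\<^sub>R frechet_derivative f (at x) b)"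
    by (simp only: sum scaleR)
  then show ?thesis
    by (simp add: euclidean_representation)
qed

text \<open>For a fixed list \<open>bs\<close> the terms from index \<open>length bs\<close> on are
  dominated by a geometric series. Hence every series of derivatives converges uniformly and the sum
  may be differentiated termwise. This is the form of completeness that the gliding hump
  uses.\<close>

lemma test_series:
  fixes g :: "nat \<Rightarrow> 'a::euclidean_space \<Rightarrow> complex"
  assumes "compact K" and g: "\<And>j. g j \<in> test_ball K j ((1/2) ^ j)"
  defines "S \<equiv> \<lambda>x. \<Sum>j. g j x"
  shows "S \<in> test_functions" and "test_null_seq K (\<lambda>m x. S x - (\<Sum>j<m. g j x))"
proof -
  \<comment> \<open>The termwise derivative of the series, as candidate for
    \<open>partials bs S\<close>.\<close>
  define D where "D bs x = (\<Sum>j. partials bs (g j) x)" for bs x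
  have gt: "g j \<in> test_functions" and gK: "{x. g j x \<noteq> 0} \<subseteq> K" for j
    using g[of j] by (auto simp: test_ball_def)
  have bnd: "cmod (partials bs (g j) x) \<le> (1/2) ^ j" if "bs \<in> lists Basis" "length bs \<le> j" for bs j x
    using g[of j] that unfolding test_ball_def by (blast intro: less_imp_le)
  have summ: "summable (\<lambda>j. partials bs (g j) x)" if "bs \<in> lists Basis" for bs x
    by (rule summable_comparison_test'[of "\<lambda>j. (1/2) ^ j" "length bs"])
       (use bnd[OF that] in \<open>auto intro!: summable_geometric\<close>)
  \<comment> \<open>The geometric bound holds only from index \<open>length bs\<close> on, which the
    condition on \<open>m\<close> ensures for the whole tail; the tail of the majorant is twice its
    first term.\<close>
  have tail: "cmod (D bs x - (\<Sum>j<m. partials bs (g j) x)) \<le> 2 * (1/2) ^ m"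
    if bs: "bs \<in> lists Basis" and m: "length bs \<le> m" for bs m x
  proof -
    have geo: "(\<lambda>j. (1/2) ^ (j + m)) sums (2 * (1/2) ^ m :: real)"
      using sums_mult2[OF geometric_sums[of "1/2::real"], of "(1/2) ^ m"] by (simp add: power_add)
    have "D bs x - (\<Sum>j<m. partials bs (g j) x) = (\<Sum>j. partials bs (g (j + m)) x)"
      unfolding D_def using suminf_split_initial_segment[OF summ[OF bs], of x m] by simp
    also have "cmod \<dots> \<le> (\<Sum>j. (1/2) ^ (j + m))"
      using bnd[OF bs] m by (intro norm_suminf_le sums_summable[OF geo]) auto
    also have "\<dots> = 2 * (1/2) ^ m"
      using sums_unique[OF geo] by simp
    finally show ?thesis .
  qed
  \<comment> \<open>The theorem on series needs total derivatives, which are rebuilt from the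
    partial ones by \<open>frechet_derivative_Basis\<close>. The lists \<open>b # bs\<close> are one
    longer than \<open>bs\<close>, so \<open>tail\<close> controls them only from
    \<open>Suc (length bs)\<close> on.\<close>
  have deriv: "(D bs has_derivative (\<lambda>h. \<Sum>b\<in>Basis. (h \<bullet> b) *\<^sub>R D (b # bs) x)) (at x)"
    if bs: "bs \<in> lists Basis" for bs x
  proof -
    have "\<exists>G. \<forall>x\<in>UNIV. (\<lambda>j. partials bs (g j) x) sums (G x) \<and>
        (G has_derivative (\<lambda>h. \<Sum>b\<in>Basis. (h \<bullet> b) *\<^sub>R D (b # bs) x)) (at x within UNIV)"
    proof (rule has_derivative_series[where f' = "\<lambda>j x h. \<Sum>b\<in>Basis. (h \<bullet> b) *\<^sub>R partials (b # bs) (g j) x"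
          and x = 0])
      fix j x
      have "partials bs (g j) differentiable (at x)"
        using gt[of j] bs by (auto simp: test_functions_iff smooth_def)
      then show "(partials bs (g j) has_derivative (\<lambda>h. \<Sum>b\<in>Basis. (h \<bullet> b) *\<^sub>R partials (b # bs) (g j) x)) (at x within UNIV)"
        using frechet_derivative_works frechet_derivative_Basis by (auto simp flip: frechet_derivative_Basis)
    next
      fix e :: real assume "e > 0"
      have "(\<lambda>m. real DIM('a) * (2 * (1/2) ^ m)) \<longlonglongrightarrow> real DIM('a) * (2 * 0)"
        by (intro tendsto_intros) auto
      then have "\<forall>\<^sub>F m in sequentially. real DIM('a) * (2 * (1/2) ^ m) < e"
        using \<open>e > 0\<close> by (intro order_tendstoD) auto
      then show "\<forall>\<^sub>F m in sequentially. \<forall>x\<in>UNIV. \<forall>h.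
          cmod ((\<Sum>j<m. \<Sum>b\<in>Basis. (h \<bullet> b) *\<^sub>R partials (b # bs) (g j) x) - (\<Sum>b\<in>Basis. (h \<bullet> b) *\<^sub>R D (b # bs) x))
          \<le> e * norm h"
        using eventually_ge_at_top[of "Suc (length bs)"]
      proof eventually_elim
        case (elim m)
        show ?case
        proof (intro ballI allI)
          fix x h
          have "cmod ((\<Sum>j<m. \<Sum>b\<in>Basis. (h \<bullet> b) *\<^sub>R partials (b # bs) (g j) x) - (\<Sum>b\<in>Basis. (h \<bullet> b) *\<^sub>R D (b # bs) x))
            = cmod (\<Sum>b\<in>Basis. (h \<bullet> b) *\<^sub>R (D (b # bs) x - (\<Sum>j<m. partials (b # bs) (g j) x)))"
            unfolding sum.swap[of _ Basis] scaleR_diff_right sum_subtractf scaleR_sum_right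
            by (subst norm_minus_commute) simp
          also have "\<dots> \<le> (\<Sum>b\<in>(Basis::'a set). norm h * (2 * (1/2) ^ m))"
            using bs elim(2)
            by (intro sum_norm_le) (auto simp del: partials.simps intro!: mult_mono tail Basis_le_norm)
          also have "\<dots> = (real DIM('a) * (2 * (1/2) ^ m)) * norm h"
            by simp
          also have "\<dots> \<le> e * norm h"
            using elim(1) by (intro mult_right_mono) auto
          finally show "cmod ((\<Sum>j<m. \<Sum>b\<in>Basis. (h \<bullet> b) *\<^sub>R partials (b # bs) (g j) x) - (\<Sum>b\<in>Basis. (h \<bullet> b) *\<^sub>R D (b # bs) x))
            \<le> e * norm h" .
        qed
      qed
    next
      show "(\<lambda>j. partials bs (g j) 0) sums D bs 0"
        unfolding D_def by (intro summable_sums summ bs)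
    qed auto
    then obtain G where G: "\<And>x. (\<lambda>j. partials bs (g j) x) sums (G x)"
        "\<And>x. (G has_derivative (\<lambda>h. \<Sum>b\<in>Basis. (h \<bullet> b) *\<^sub>R D (b # bs) x)) (at x)"
      by auto
    have "G = D bs"
      using sums_unique[OF G(1)] by (auto simp: D_def)
    with G(2) show ?thesis by simp
  qed
  have S: "partials bs S = D bs" if "bs \<in> lists Basis" for bs
    using that
  proof (induction bs)
    case Nil
    then show ?case by (auto simp: S_def D_def)
  next
    case (Cons b bs)
    from Cons have "frechet_derivative (D bs) (at x) = (\<lambda>h. \<Sum>b\<in>Basis. (h \<bullet> b) *\<^sub>R D (b # bs) x)" for x
      using frechet_derivative_at[OF deriv[of bs x]] by auto
    moreover have "(\<Sum>b'\<in>Basis. (b \<bullet> b') *\<^sub>R D (b' # bs) x) = D (b # bs) x" for x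
    proof -
      have "(\<Sum>b'\<in>Basis. (b \<bullet> b') *\<^sub>R D (b' # bs) x) = (\<Sum>b'\<in>Basis. if b' = b then D (b # bs) x else 0)"
        by (intro sum.cong refl) (simp add: inner_Basis Cons.hyps(1))
      then show ?thesis
        by (simp add: Cons.hyps(1))
    qed
    ultimately show ?case
      using Cons by auto
  qed
  have "smooth S"
    unfolding smooth_def
  proof (intro ballI allI)
    fix bs :: "'a list" and x assume "bs \<in> lists Basis"
    then show "partials bs S differentiable (at x)"
      using S[of bs] deriv[of bs x] by (auto simp: differentiable_def)
  qed
  moreover have SK: "{x. S x \<noteq> 0} \<subseteq> K"
  proof
    fix x assume "x \<in> {x. S x \<noteq> 0}"
    then have "\<exists>j. g j x \<noteq> 0"
      by (auto simp: S_def intro: ccontr)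
    then show "x \<in> K" using gK by blast
  qed
  ultimately show St: "S \<in> test_functions"
    using compact_imp_bounded[OF assms(1)] by (auto simp: test_functions_iff intro: bounded_subset)
  have Pt: "(\<lambda>x. \<Sum>j<m. g j x) \<in> test_functions" for m
    using gt by (intro test_functions_sum) auto
  show "test_null_seq K (\<lambda>m x. S x - (\<Sum>j<m. g j x))"
    unfolding test_null_seq_def
  proof (intro conjI allI ballI)
    show "(\<lambda>x. S x - (\<Sum>j<m. g j x)) \<in> test_functions" for m
      by (intro test_functions_diff St Pt)
    show "{x. S x - (\<Sum>j<m. g j x) \<noteq> 0} \<subseteq> K" for m
    proof
      fix x assume *: "x \<in> {x. S x - (\<Sum>j<m. g j x) \<noteq> 0}"
      show "x \<in> K"
      proof (rule ccontr)
        assume "x \<notin> K"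
        then have "S x = 0" "\<And>j. g j x = 0" using SK gK by blast+
        with * show False by simp
      qed
    qed
    fix bs :: "'a list" assume bs: "bs \<in> lists Basis"
    have eq: "partials bs (\<lambda>x. S x - (\<Sum>j<m. g j x)) = (\<lambda>x. D bs x - (\<Sum>j<m. partials bs (g j) x))" for m
      using gt by (simp add: partials_diff[OF St Pt bs] partials_sum[OF _ _ bs] S[OF bs])
    show "uniform_limit UNIV (\<lambda>m. partials bs (\<lambda>x. S x - (\<Sum>j<m. g j x))) (\<lambda>_. 0) sequentially"
      unfolding uniform_limit_iff
    proof (intro allI impI)
      fix e :: real assume "e > 0"
      have "(\<lambda>m. 2 * (1/2) ^ m :: real) \<longlonglongrightarrow> 2 * 0"
        by (intro tendsto_intros) auto
      then have "\<forall>\<^sub>F m in sequentially. 2 * (1/2) ^ m < e"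
        using \<open>e > 0\<close> by (intro order_tendstoD) auto
      then show "\<forall>\<^sub>F m in sequentially. \<forall>x\<in>UNIV. dist (partials bs (\<lambda>x. S x - (\<Sum>j<m. g j x)) x) 0 < e"
        using eventually_ge_at_top[of "length bs"]
      proof eventually_elim
        case (elim m)
        then show ?case
          using tail[OF bs elim(2)] by (auto simp: eq intro: le_less_trans)
      qed
    qed
  qed
qed

text \<open>
  A gliding hump replaces the Banach--Steinhaus theorem on the Frechet space of test functions
  supported in \<open>K\<close>: were \<open>T n (\<psi> n)\<close> not to tend to \<open>0\<close>, the sum of a sufficiently sparse
  subsequence of \<open>\<psi>\<close> would be a test function at which \<open>T\<close> does not tend to \<open>0\<close>.
\<close>

lemma gliding_hump:
  fixes T :: "nat \<Rightarrow> ('a::euclidean_space \<Rightarrow> complex) \<Rightarrow> complex"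
  assumes "compact K"
    and add: "\<And>n \<phi> \<psi>. \<phi> \<in> test_functions \<Longrightarrow> \<psi> \<in> test_functions \<Longrightarrow> T n (\<lambda>x. \<phi> x + \<psi> x) = T n \<phi> + T n \<psi>"
    and cont: "\<And>n g. test_null_seq K g \<Longrightarrow> (\<lambda>m. T n (g m)) \<longlonglongrightarrow> 0"
    and pw: "\<And>\<phi>. \<phi> \<in> test_functions \<Longrightarrow> (\<lambda>n. T n \<phi>) \<longlonglongrightarrow> 0"
    and \<psi>: "test_null_seq K \<psi>"
  shows "(\<lambda>n. T n (\<psi> n)) \<longlonglongrightarrow> 0"
proof (rule ccontr)
  assume "\<not> (\<lambda>n. T n (\<psi> n)) \<longlonglongrightarrow> 0"
  then obtain \<delta> where "\<delta> > 0" and hump: "\<exists>\<^sub>F n in sequentially. cmod (T n (\<psi> n)) \<ge> \<delta>"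
    unfolding tendsto_iff frequently_def by (auto simp: not_less not_eventually)
  have \<psi>t: "\<psi> n \<in> test_functions" for n
    using \<psi> by (auto simp: test_null_seq_def)
  \<comment> \<open>The conditions on \<open>n\<close> as the next index \<open>r j\<close>: the
    hump is small enough for \<open>test_series\<close>, the earlier functionals hardly see it, the
    new functional hardly sees the earlier humps, and the diagonal value stays large. The exponents
    are such that \<open>T (r j) (\<psi> (r i))\<close> is at most
    \<open>\<delta> / 8 * (1/2) ^ i\<close> for all \<open>i \<noteq> j\<close>;
    \<open>j \<le> n\<close> makes \<open>r\<close> tend to infinity.\<close>
  define P where "P r j n \<longleftrightarrow> j \<le> n \<and> \<psi> n \<in> test_ball K j ((1/2) ^ j) \<and>
      (\<forall>i<j. cmod (T (r i) (\<psi> n)) \<le> \<delta> / 8 * (1/2) ^ j) \<and>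
      (\<forall>i<j. cmod (T n (\<psi> (r i))) \<le> \<delta> / 8 * (1/2) ^ i) \<and> \<delta> \<le> cmod (T n (\<psi> n))" for r j n
  have "\<exists>r. \<forall>j. P r j (r j)"
  proof (rule dependent_wellorder_choice)
    show "P r j n = P r' j n" if "\<And>i. i < j \<Longrightarrow> r i = r' i" for n r r' j
      using that by (simp add: P_def)
    fix j r
    have small: "\<forall>\<^sub>F n in sequentially. cmod (X n) \<le> e" if "X \<longlonglongrightarrow> 0" "e > 0" for X :: "nat \<Rightarrow> complex" and e
      using that by (auto simp: tendsto_iff elim!: eventually_mono allE[of _ e])
    \<comment> \<open>For the finitely many \<open>i < j\<close>, continuity of the fixed
      \<open>T (r i)\<close> along \<open>\<psi>\<close> gives the first estimate, and pointwise
      convergence at the fixed \<open>\<psi> (r i)\<close> the second. All this holds eventually,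
      while the lower bound on the diagonal holds frequently.\<close>
    have "\<forall>\<^sub>F n in sequentially. j \<le> n \<and> \<psi> n \<in> test_ball K j ((1/2) ^ j) \<and>
        (\<forall>i\<in>{..<j}. cmod (T (r i) (\<psi> n)) \<le> \<delta> / 8 * (1/2) ^ j) \<and>
        (\<forall>i\<in>{..<j}. cmod (T n (\<psi> (r i))) \<le> \<delta> / 8 * (1/2) ^ i)"
      using \<open>\<delta> > 0\<close>
      by (intro eventually_conj eventually_ball_finite ballI small cont pw \<psi> \<psi>t eventually_ge_at_top
            test_null_seq_eventually_ball) auto
    with hump have "\<exists>\<^sub>F n in sequentially. P r j n"
      unfolding P_def by (rule frequently_eventually_frequently[THEN frequently_elim1]) auto
    then show "\<exists>n. P r j n"
      by (rule frequently_ex)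
  qed
  then obtain r where r: "\<And>j. P r j (r j)" by auto
  define S where "S = (\<lambda>x. \<Sum>j. \<psi> (r j) x)"
  have "\<psi> (r j) \<in> test_ball K j ((1/2) ^ j)" for j
    using r[of j] by (simp add: P_def)
  note S = test_series[where g = "\<lambda>j. \<psi> (r j)", OF assms(1) this]
  have S: "S \<in> test_functions" "test_null_seq K (\<lambda>m x. S x - (\<Sum>j<m. \<psi> (r j) x))"
    unfolding S_def by (fact S)+
  have sum: "T n (\<lambda>x. \<Sum>i<m. \<psi> (r i) x) = (\<Sum>i<m. T n (\<psi> (r i)))" for n m
  proof (induction m)
    case 0
    show ?case
      using add[OF test_functions_0 test_functions_0] by simp
  next
    case (Suc m)
    then show ?case
      using add[OF test_functions_sum \<psi>t, of "{..<m}" "\<lambda>i. \<psi> (r i)"] \<psi>t by simp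
  qed
  \<comment> \<open>Continuity of the single functional \<open>T n\<close> extends its additivity
    from partial sums to the series.\<close>
  have lim: "(\<lambda>m. \<Sum>i<m. T n (\<psi> (r i))) \<longlonglongrightarrow> T n S" for n
  proof -
    have "T n (\<lambda>x. S x - (\<Sum>i<m. \<psi> (r i) x)) = T n S - (\<Sum>i<m. T n (\<psi> (r i)))" for m
      using add[OF test_functions_diff[OF S(1) test_functions_sum] test_functions_sum,
          of "{..<m}" "\<lambda>i. \<psi> (r i)" "{..<m}" "\<lambda>i. \<psi> (r i)"] \<psi>t
      by (simp add: sum algebra_simps)
    with cont[OF S(2), of n] have "(\<lambda>m. T n S - (\<Sum>i<m. T n (\<psi> (r i)))) \<longlonglongrightarrow> 0"
      by simp
    from tendsto_diff[OF tendsto_const[of "T n S"] this] show ?thesis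
      by simp
  qed
  \<comment> \<open>Once \<open>m > j\<close>, the diagonal term has modulus at least \<delta>, and
    the others contribute at most \<delta>/4 in total.\<close>
  have "\<delta> / 2 \<le> cmod (T (r j) S)" for j
  proof (rule tendsto_lowerbound[OF tendsto_norm[OF lim]])
    show "\<forall>\<^sub>F m in sequentially. \<delta> / 2 \<le> cmod (\<Sum>i<m. T (r j) (\<psi> (r i)))"
      using eventually_gt_at_top[of j]
    proof eventually_elim
      case (elim m)
      have "cmod (T (r j) (\<psi> (r i))) \<le> \<delta> / 8 * (1/2) ^ i" if "i \<noteq> j" for i
        using that r[of i] r[of j] by (cases i j rule: linorder_cases) (auto simp: P_def)
      then have "cmod (\<Sum>i\<in>{..<m} - {j}. T (r j) (\<psi> (r i))) \<le> (\<Sum>i\<in>{..<m} - {j}. \<delta> / 8 * (1/2) ^ i)"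
        by (intro sum_norm_le) auto
      also have "\<dots> \<le> (\<Sum>i<m. \<delta> / 8 * (1/2) ^ i)"
        using \<open>\<delta> > 0\<close> by (intro sum_mono2) auto
      also have "\<dots> = \<delta> / 8 * (2 - 2 * (1/2) ^ m)"
        unfolding sum_distrib_left[symmetric] by (simp add: sum_gp_strict)
      also have "\<dots> \<le> \<delta> / 4"
        using \<open>\<delta> > 0\<close> by (simp add: field_simps)
      finally have "cmod (\<Sum>i\<in>{..<m} - {j}. T (r j) (\<psi> (r i))) \<le> \<delta> / 4" .
      moreover have "(\<Sum>i<m. T (r j) (\<psi> (r i))) = T (r j) (\<psi> (r j)) + (\<Sum>i\<in>{..<m} - {j}. T (r j) (\<psi> (r i)))"
        using elim by (intro sum.remove) auto
      moreover have "\<delta> \<le> cmod (T (r j) (\<psi> (r j)))"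
        using r[of j] by (simp add: P_def)
      ultimately show ?case
        using \<open>\<delta> > 0\<close> norm_diff_ineq[of "T (r j) (\<psi> (r j))" "\<Sum>i\<in>{..<m} - {j}. T (r j) (\<psi> (r i))"] by simp
    qed
  qed simp
  moreover have "filterlim r at_top sequentially"
    using r by (intro filterlim_at_top_mono[OF filterlim_ident]) (auto simp: P_def)
  then have "(\<lambda>j. T (r j) S) \<longlonglongrightarrow> 0"
    by (rule filterlim_compose[OF pw[OF S(1)]])
  ultimately have "\<delta> / 2 \<le> cmod 0"
    by (intro tendsto_lowerbound[OF tendsto_norm]) auto
  with \<open>\<delta> > 0\<close> show False by simp
qed

section \<open>Null sequences under integration and changes of variable\<close>

lemma integral_test_null_seq:
  fixes g :: "nat \<Rightarrow> 'a::euclidean_space \<Rightarrow> complex"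
  assumes "compact K" "test_null_seq K g"
  shows "(\<lambda>n. LINT x|lborel. g n x) \<longlonglongrightarrow> 0"
proof (rule tendstoI)
  fix e :: real assume "e > 0"
  \<comment> \<open>The summand 1 keeps the divisor \<open>M\<close> positive when \<open>K\<close>
    has measure 0.\<close>
  define M where "M = measure lborel K + 1"
  have "M > 0"
    by (simp add: M_def add_nonneg_pos)
  have "\<forall>\<^sub>F n in sequentially. \<forall>x\<in>UNIV. dist (partials [] (g n) x) 0 < e / M"
    using assms(2) \<open>e > 0\<close> \<open>M > 0\<close>
    unfolding test_null_seq_def uniform_limit_iff by (blast intro: divide_pos_pos lists.Nil)
  then show "\<forall>\<^sub>F n in sequentially. dist (LINT x|lborel. g n x) 0 < e"
  proof eventually_elim
    case (elim n)
    have gn: "g n \<in> test_functions" "{x. g n x \<noteq> 0} \<subseteq> K"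
      using assms(2) by (auto simp: test_null_seq_def)
    have fin: "emeasure lborel K < \<infinity>"
      by (rule emeasure_compact_finite[OF assms(1)])
    have "cmod (LINT x|lborel. g n x) \<le> (LINT x|lborel. cmod (g n x))"
      by (rule integral_norm_bound)
    also have "\<dots> \<le> (LINT x|lborel. e / M * indicator K x)"
    proof (rule integral_mono)
      show "integrable lborel (\<lambda>x. cmod (g n x))"
        by (intro integrable_norm integrable_test gn)
      show "integrable lborel (\<lambda>x. e / M * indicator K x :: real)"
        using fin assms(1) by (intro integrable_mult_right integrable_real_indicator) (auto simp: borel_compact)
      show "cmod (g n x) \<le> e / M * indicator K x" for x
        using elim gn(2) \<open>e > 0\<close> \<open>M > 0\<close>
        by (cases "x \<in> K") (auto intro: less_imp_le)
    qed
    also have "\<dots> = e / M * measure lborel K"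
      using assms(1) by (simp add: borel_compact)
    also have "\<dots> < e"
      using \<open>e > 0\<close> \<open>M > 0\<close> by (simp add: field_simps M_def)
    finally show ?case by simp
  qed
qed

text \<open>The supports move to the preimage of \<open>K\<close>, and a derivative of given order
  is only multiplied by a fixed power of \<open>c\<close>. This yields the continuity of the
  rescaled functionals.\<close>

lemma test_null_seq_affine:
  fixes g :: "nat \<Rightarrow> 'a::euclidean_space \<Rightarrow> complex"
  assumes "test_null_seq K g" "c \<noteq> 0"
  shows "test_null_seq ((\<lambda>y. (1 / c) *\<^sub>R (y - a)) ` K) (\<lambda>n x. g n (c *\<^sub>R x + a))"
  unfolding test_null_seq_def
proof (intro conjI allI ballI)
  have g: "g n \<in> test_functions" "{x. g n x \<noteq> 0} \<subseteq> K" for n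
    using assms(1) by (auto simp: test_null_seq_def)
  show "(\<lambda>x. g n (c *\<^sub>R x + a)) \<in> test_functions" for n
    by (intro test_functions_affine g assms)
  show "{x. g n (c *\<^sub>R x + a) \<noteq> 0} \<subseteq> (\<lambda>y. (1 / c) *\<^sub>R (y - a)) ` K" for n
  proof
    fix x assume "x \<in> {x. g n (c *\<^sub>R x + a) \<noteq> 0}"
    then show "x \<in> (\<lambda>y. (1 / c) *\<^sub>R (y - a)) ` K"
      using g(2)[of n] assms(2) by (intro image_eqI[of _ _ "c *\<^sub>R x + a"]) auto
  qed
  fix bs :: "'a list" assume bs: "bs \<in> lists Basis"
  have eq: "partials bs (\<lambda>x. g n (c *\<^sub>R x + a)) = (\<lambda>x. c ^ length bs *\<^sub>R partials bs (g n) (c *\<^sub>R x + a))" for n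
    using g(1)[of n] by (intro partials_affine bs) (simp add: test_functions_iff)
  show "uniform_limit UNIV (\<lambda>n. partials bs (\<lambda>x. g n (c *\<^sub>R x + a))) (\<lambda>_. 0) sequentially"
    unfolding uniform_limit_iff
  proof (intro allI impI)
    fix e :: real assume "e > 0"
    define A where "A = \<bar>c\<bar> ^ length bs"
    have "A > 0" using assms(2) by (simp add: A_def)
    have "\<forall>\<^sub>F n in sequentially. \<forall>x\<in>UNIV. dist (partials bs (g n) x) 0 < e / A"
      using assms(1) bs \<open>e > 0\<close> \<open>A > 0\<close> unfolding test_null_seq_def uniform_limit_iff
      by (blast intro: divide_pos_pos)
    then show "\<forall>\<^sub>F n in sequentially. \<forall>x\<in>UNIV. dist (partials bs (\<lambda>x. g n (c *\<^sub>R x + a)) x) 0 < e"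
    proof eventually_elim
      case (elim n)
      show ?case
      proof
        fix x
        have "cmod (partials bs (g n) (c *\<^sub>R x + a)) < e / A"
          using elim by simp
        then show "dist (partials bs (\<lambda>x. g n (c *\<^sub>R x + a)) x) 0 < e"
          using \<open>A > 0\<close> unfolding eq by (simp add: power_abs A_def field_simps)
      qed
    qed
  qed
qed

text \<open>Since \<open>c k \<ge> 1\<close>, dilating does not push the support out of the ball.
  With \<open>\<eta>\<close> a derivative of \<open>\<phi>\<close> of order \<open>m\<close>, the
  difference \<open>c k ^ m *\<^sub>R \<eta> (c k *\<^sub>R x) - \<eta> x\<close> is split so that
  boundedness of \<open>\<eta>\<close> handles the change of the factor and uniform continuity the
  change of the argument.\<close>

lemma test_null_seq_dilation:
  fixes \<phi> :: "'a::euclidean_space \<Rightarrow> complex"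
  assumes \<phi>: "\<phi> \<in> test_functions" "{x. \<phi> x \<noteq> 0} \<subseteq> cball 0 R" and "R > 0"
    and c: "\<And>k. c k \<ge> 1" "c \<longlonglongrightarrow> 1"
  shows "test_null_seq (cball 0 R) (\<lambda>k x. \<phi> (c k *\<^sub>R x) - \<phi> x)"
  unfolding test_null_seq_def
proof (intro conjI allI ballI)
  have \<phi>c: "(\<lambda>x. \<phi> (c k *\<^sub>R x)) \<in> test_functions" for k
    using test_functions_affine[OF \<phi>(1), of "c k" 0] c(1)[of k] by simp
  have out: "x \<notin> cball 0 R \<Longrightarrow> c k *\<^sub>R x \<notin> cball 0 R" for x :: 'a and k
    using c(1)[of k] mult_right_mono[of 1 "c k" "norm x"] by (auto simp: not_le)
  show "(\<lambda>x. \<phi> (c k *\<^sub>R x) - \<phi> x) \<in> test_functions" for k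
    by (intro test_functions_diff \<phi>c \<phi>)
  show "{x. \<phi> (c k *\<^sub>R x) - \<phi> x \<noteq> 0} \<subseteq> cball 0 R" for k
  proof
    fix x assume *: "x \<in> {x. \<phi> (c k *\<^sub>R x) - \<phi> x \<noteq> 0}"
    show "x \<in> cball 0 R"
    proof (rule ccontr)
      assume "x \<notin> cball 0 R"
      then have "\<phi> x = 0" "\<phi> (c k *\<^sub>R x) = 0"
        using \<phi>(2) out[of x k] by blast+
      with * show False by simp
    qed
  qed
  fix bs :: "'a list" assume bs: "bs \<in> lists Basis"
  define \<eta> where "\<eta> = partials bs \<phi>"
  define m where "m = length bs"
  have eq: "partials bs (\<lambda>x. \<phi> (c k *\<^sub>R x) - \<phi> x) = (\<lambda>x. c k ^ m *\<^sub>R \<eta> (c k *\<^sub>R x) - \<eta> x)" for k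
    using partials_affine[of \<phi> bs "c k" 0] \<phi>(1) bs
    by (simp add: partials_diff[OF \<phi>c \<phi>(1) bs] test_functions_iff \<eta>_def m_def)
  have \<eta>0: "\<eta> x = 0" if "x \<notin> cball 0 R" for x
    unfolding \<eta>_def using partials_eq_0_outside[OF closed_cball \<phi>(2) that] .
  obtain B where B: "B > 0" "\<And>x. cmod (\<eta> x) \<le> B"
    using bounded_partials[OF \<phi>(1) bs] unfolding \<eta>_def by blast
  \<comment> \<open>The radius is doubled to contain both \<open>x\<close> and
    \<open>c k *\<^sub>R x\<close> as soon as \<open>c k < 2\<close>.\<close>
  have uc: "uniformly_continuous_on (cball 0 (2 * R)) \<eta>"
    unfolding \<eta>_def by (intro compact_uniformly_continuous continuous_partials \<phi> bs compact_cball)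
  show "uniform_limit UNIV (\<lambda>k. partials bs (\<lambda>x. \<phi> (c k *\<^sub>R x) - \<phi> x)) (\<lambda>_. 0) sequentially"
    unfolding uniform_limit_iff
  proof (intro allI impI)
    fix e :: real assume "e > 0"
    obtain d where d: "d > 0" "\<And>x y. x \<in> cball 0 (2 * R) \<Longrightarrow> y \<in> cball 0 (2 * R) \<Longrightarrow> dist y x < d \<Longrightarrow> dist (\<eta> y) (\<eta> x) < e / 2"
      using uc \<open>e > 0\<close> unfolding uniformly_continuous_on_def by (meson half_gt_zero)
    have lim: "(\<lambda>k. \<bar>c k ^ m - 1\<bar> * B) \<longlonglongrightarrow> \<bar>1 ^ m - 1\<bar> * B" "(\<lambda>k. \<bar>c k - 1\<bar> * R) \<longlonglongrightarrow> \<bar>1 - 1\<bar> * R"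
      by (intro tendsto_intros c)+
    have "\<forall>\<^sub>F k in sequentially. \<bar>c k ^ m - 1\<bar> * B < e / 2"
        "\<forall>\<^sub>F k in sequentially. \<bar>c k - 1\<bar> * R < d" "\<forall>\<^sub>F k in sequentially. c k < 2"
      using \<open>e > 0\<close> \<open>d > 0\<close> order_tendstoD(2)[OF lim(1), of "e / 2"] order_tendstoD(2)[OF lim(2), of d]
        order_tendstoD(2)[OF c(2), of 2] by simp_all
    then show "\<forall>\<^sub>F k in sequentially. \<forall>x\<in>UNIV. dist (partials bs (\<lambda>x. \<phi> (c k *\<^sub>R x) - \<phi> x) x) 0 < e"
    proof eventually_elim
      case (elim k)
      show ?case
      proof
        fix x
        show "dist (partials bs (\<lambda>x. \<phi> (c k *\<^sub>R x) - \<phi> x) x) 0 < e"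
        proof (cases "x \<in> cball 0 R")
          case False
          then show ?thesis
            using \<eta>0[OF False] \<eta>0[OF out[OF False]] \<open>e > 0\<close> by (simp add: eq)
        next
          case True
          have "norm (c k *\<^sub>R x) \<le> 2 * R"
            using True elim(3) c(1)[of k] by (auto intro!: mult_mono)
          moreover have "dist (c k *\<^sub>R x) x = \<bar>c k - 1\<bar> * norm x"
            by (simp add: dist_norm flip: norm_scaleR scaleR_left_diff_distrib)
               (simp add: algebra_simps)
          then have "dist (c k *\<^sub>R x) x < d"
            using True elim(2) mult_left_mono[of "norm x" R "\<bar>c k - 1\<bar>"] by simp
          ultimately have 1: "cmod (\<eta> (c k *\<^sub>R x) - \<eta> x) < e / 2"
            using d(2)[of x "c k *\<^sub>R x"] True \<open>R > 0\<close> by (simp add: dist_norm)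
          have "cmod ((c k ^ m - 1) *\<^sub>R \<eta> (c k *\<^sub>R x)) \<le> \<bar>c k ^ m - 1\<bar> * B"
            by (simp add: mult_left_mono B)
          then have 2: "cmod ((c k ^ m - 1) *\<^sub>R \<eta> (c k *\<^sub>R x)) < e / 2"
            using elim(1) by linarith
          have split: "c k ^ m *\<^sub>R \<eta> (c k *\<^sub>R x) - \<eta> x = (c k ^ m - 1) *\<^sub>R \<eta> (c k *\<^sub>R x) + (\<eta> (c k *\<^sub>R x) - \<eta> x)"
            by (simp add: algebra_simps)
          have "cmod (c k ^ m *\<^sub>R \<eta> (c k *\<^sub>R x) - \<eta> x) < e"
            unfolding split using norm_triangle_ineq[of "(c k ^ m - 1) *\<^sub>R \<eta> (c k *\<^sub>R x)" "\<eta> (c k *\<^sub>R x) - \<eta> x"] 1 2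
            by linarith
          then show ?thesis
            by (simp add: eq)
        qed
      qed
    qed
  qed
qed

section \<open>Dilations of distributions\<close>

lemma distribution_add:
  "distribution f \<Longrightarrow> \<phi> \<in> test_functions \<Longrightarrow> \<psi> \<in> test_functions \<Longrightarrow> f (\<lambda>x. \<phi> x + \<psi> x) = f \<phi> + f \<psi>"
  by (simp add: distribution_def)

lemma distribution_cmult:
  "distribution f \<Longrightarrow> \<phi> \<in> test_functions \<Longrightarrow> f (\<lambda>x. c * \<phi> x) = c * f \<phi>"
  by (simp add: distribution_def)

lemma distribution_0: "distribution f \<Longrightarrow> f (\<lambda>x. 0) = 0"
  using distribution_cmult[OF _ test_functions_0, of f 0] by simp

text \<open>Here the inductive limit topology enters: the preimage of a ball around 0 is open and
  contains 0, so it contains some \<open>test_ball K N \<delta>\<close>, in which the sequence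
  eventually lies.\<close>

lemma distribution_test_null_seq:
  fixes f :: "('a::euclidean_space \<Rightarrow> complex) \<Rightarrow> complex"
  assumes "distribution f" "compact K" "test_null_seq K g"
  shows "(\<lambda>n. f (g n)) \<longlonglongrightarrow> 0"
proof (rule tendstoI)
  fix e :: real assume "e > 0"
  have "openin test_topology {\<phi> \<in> topspace test_topology. f \<phi> \<in> ball 0 e}"
    using assms(1) by (intro openin_continuous_map_preimage[of _ euclidean]) (auto simp: distribution_def)
  then have "test_open {\<phi> \<in> test_functions. f \<phi> \<in> ball 0 e}"
    by (simp add: openin_test_topology topspace_test_topology)
  moreover have "(\<lambda>x. 0) \<in> {\<phi> \<in> test_functions. f \<phi> \<in> ball 0 e}"
    using \<open>e > 0\<close> by (simp add: test_functions_0 distribution_0[OF assms(1)])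
  ultimately obtain W where W: "zero_nbhd W" "\<forall>\<psi>\<in>W. (\<lambda>x. 0 + \<psi> x) \<in> {\<phi> \<in> test_functions. f \<phi> \<in> ball 0 e}"
    unfolding test_open_def by blast
  then obtain N \<delta> where "\<delta> > 0" "test_ball K N \<delta> \<subseteq> W"
    using assms(2) unfolding zero_nbhd_def by meson
  have "\<forall>\<^sub>F n in sequentially. g n \<in> test_ball K N \<delta>"
    by (rule test_null_seq_eventually_ball) fact+
  then show "\<forall>\<^sub>F n in sequentially. dist (f (g n)) 0 < e"
  proof eventually_elim
    case (elim n)
    then have "g n \<in> W" using \<open>test_ball K N \<delta> \<subseteq> W\<close> by blast
    then have "(\<lambda>x. 0 + g n x) \<in> {\<phi> \<in> test_functions. f \<phi> \<in> ball 0 e}"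
      using W(2) by blast
    then show ?case by simp
  qed
qed

section \<open>Linearity, continuity and scaling of the rescaled functionals\<close>

lemma test_functions_rescale:
  "\<phi> \<in> test_functions \<Longrightarrow> \<epsilon> \<noteq> 0 \<Longrightarrow> (\<lambda>y. \<phi> ((y - x\<^sub>0) /\<^sub>R \<epsilon>)) \<in> test_functions"
  using test_functions_affine[of \<phi> "inverse \<epsilon>" "- inverse \<epsilon> *\<^sub>R x\<^sub>0"]
  by (simp add: scaleR_diff_right)

lemma shift_dilate_alt:
  fixes f :: "('a::euclidean_space \<Rightarrow> complex) \<Rightarrow> complex"
  shows "shift_dilate f x\<^sub>0 \<epsilon> \<phi> =
    complex_of_real (inverse (\<bar>\<epsilon>\<bar> ^ DIM('a))) * f (\<lambda>y. \<phi> (inverse \<epsilon> *\<^sub>R y + (- inverse \<epsilon> *\<^sub>R x\<^sub>0)))"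
  by (simp add: shift_dilate_def scaleR_diff_right)

lemma shift_dilate_add:
  assumes "distribution f" "\<epsilon> \<noteq> 0" "\<phi> \<in> test_functions" "\<psi> \<in> test_functions"
  shows "shift_dilate f x\<^sub>0 \<epsilon> (\<lambda>x. \<phi> x + \<psi> x) = shift_dilate f x\<^sub>0 \<epsilon> \<phi> + shift_dilate f x\<^sub>0 \<epsilon> \<psi>"
  unfolding shift_dilate_def
  using distribution_add[OF assms(1) test_functions_rescale test_functions_rescale, OF assms(3,2,4,2)]
  by (simp add: ring_distribs)

lemma shift_dilate_cmult:
  assumes "distribution f" "\<epsilon> \<noteq> 0" "\<phi> \<in> test_functions"
  shows "shift_dilate f x\<^sub>0 \<epsilon> (\<lambda>x. c * \<phi> x) = c * shift_dilate f x\<^sub>0 \<epsilon> \<phi>"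
  unfolding shift_dilate_def
  using distribution_cmult[OF assms(1) test_functions_rescale, OF assms(3,2)] by simp

lemma shift_dilate_test_null_seq:
  assumes "distribution f" "\<epsilon> \<noteq> 0" "compact K" "test_null_seq K g"
  shows "(\<lambda>n. shift_dilate f x\<^sub>0 \<epsilon> (g n)) \<longlonglongrightarrow> 0"
proof -
  let ?a = "- inverse \<epsilon> *\<^sub>R x\<^sub>0"
  have "compact ((\<lambda>y. (1 / inverse \<epsilon>) *\<^sub>R (y - ?a)) ` K)"
    by (intro compact_continuous_image assms continuous_intros)
  then have "(\<lambda>n. f (\<lambda>y. g n (inverse \<epsilon> *\<^sub>R y + ?a))) \<longlonglongrightarrow> 0"
    by (rule distribution_test_null_seq[OF assms(1)])
       (rule test_null_seq_affine[OF assms(4)], use assms(2) in simp)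
  then show ?thesis
    unfolding shift_dilate_alt by (rule tendsto_mult_right_zero)
qed

text \<open>Dividing the parameter by \<open>s\<close> multiplies the argument of
  \<open>\<phi>\<close> by \<open>s\<close>, and the Jacobian changes by
  \<open>\<bar>s\<bar> ^ DIM('a)\<close>. The case \<open>s = n\<close> gives the delta sequences,
  \<open>s\<close> near 1 the comparison of neighbouring parameters, and \<open>s = - 1\<close> the
  reflection.\<close>

lemma shift_dilate_mult:
  fixes f :: "('a::euclidean_space \<Rightarrow> complex) \<Rightarrow> complex"
  assumes "s \<noteq> 0"
  shows "shift_dilate f x\<^sub>0 (\<epsilon> / s) \<phi> =
    of_real (\<bar>s\<bar> ^ DIM('a)) * shift_dilate f x\<^sub>0 \<epsilon> (\<lambda>x. \<phi> (s *\<^sub>R x))"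
  using assms by (simp add: shift_dilate_def power_divide field_simps)

lemma shift_dilate_standard_delta_seq:
  assumes "distribution f" "n > 0" "\<phi> \<in> test_functions"
  shows "shift_dilate f x\<^sub>0 1 (standard_delta_seq \<phi> n) = shift_dilate f x\<^sub>0 (1 / real n) \<phi>"
proof -
  have "(\<lambda>x. \<phi> (real n *\<^sub>R x)) \<in> test_functions"
    using test_functions_affine[of \<phi> "real n" 0] assms by simp
  then show ?thesis
    using assms by (simp add: standard_delta_seq_def shift_dilate_cmult shift_dilate_mult)
qed

lemma integral_test_add:
  "\<phi> \<in> test_functions \<Longrightarrow> \<psi> \<in> test_functions \<Longrightarrow>
    (LINT x|lborel. \<phi> x + \<psi> x) = (LINT x|lborel. \<phi> x) + (LINT x|lborel. \<psi> x)"
  by (intro Bochner_Integration.integral_add integrable_test)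

section \<open>From positive normalized test functions to all test functions\<close>

text \<open>
  No bump function has to be constructed: a square of a translated dilate of \<open>\<phi>\<close> itself is
  positive on the support of \<open>\<phi>\<close>.
\<close>

lemma real_test_positive_majorant:
  fixes \<phi> :: "'a::euclidean_space \<Rightarrow> complex"
  assumes \<phi>: "\<phi> \<in> test_functions" and real: "\<And>x. \<phi> x \<in> \<real>"
  obtains \<eta> where "\<eta> \<in> test_functions" "positive_test \<eta>" "positive_test (\<lambda>x. \<phi> x + \<eta> x)"
proof (cases "\<forall>x. \<phi> x = 0")
  case True
  then show thesis
    by (intro that[of "\<lambda>x. 0"] test_functions_0) (simp_all add: positive_test_def)
next
  case False
  then obtain p where p: "\<phi> p \<noteq> 0" by auto
  define u where "u x = Re (\<phi> x)" for x
  have \<phi>u: "\<phi> x = of_real (u x)" for x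
    using real[of x] by (simp add: u_def)
  have "isCont \<phi> p"
    using continuous_test[OF \<phi>, of UNIV] by (simp add: continuous_on_eq_continuous_at)
  then have "isCont u p"
    unfolding u_def by (rule isCont_Re)
  moreover have "0 < \<bar>u p\<bar> / 2"
    using p by (simp add: \<phi>u)
  ultimately obtain d where d: "d > 0" "\<And>y. dist y p < d \<Longrightarrow> dist (u y) (u p) < \<bar>u p\<bar> / 2"
    unfolding continuous_at_eps_delta by meson
  obtain R where R: "R > 0" "{x. \<phi> x \<noteq> 0} \<subseteq> cball 0 R"
    using test_supported_in_cball[OF \<phi>] .
  obtain B where B: "B > 0" "\<And>x. cmod (\<phi> x) \<le> B"
    using bounded_partials[OF \<phi>, of "[]"] by auto
  \<comment> \<open>With this \<open>c\<close> the map \<open>x \<mapsto> c *\<^sub>R x + p\<close>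
    sends the ball of radius \<open>R\<close> into the ball of radius \<open>d\<close> around
    \<open>p\<close>, where \<open>\<bar>u\<bar>\<close> is at least half of
    \<open>\<bar>u p\<bar>\<close>. The factor \<open>C\<close> then lifts the square to at least
    \<open>B\<close>, which bounds \<open>\<bar>u\<bar>\<close>.\<close>
  define c where "c = d / (2 * R)"
  define C where "C = B / (u p / 2)\<^sup>2"
  have "c > 0" "C > 0"
    using d R B p by (simp_all add: c_def C_def \<phi>u)
  define w where "w x = C * (u (c *\<^sub>R x + p))\<^sup>2" for x
  have w: "0 \<le> w x" for x
    using \<open>C > 0\<close> by (simp add: w_def)
  have uw: "0 \<le> u x + w x" for x
  proof (cases "x \<in> cball 0 R")
    case False
    then have "\<phi> x = 0" using R(2) by blast
    then show ?thesis using w[of x] by (simp add: u_def)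
  next
    case True
    have "dist (c *\<^sub>R x + p) p < d"
    proof -
      have "c * norm x \<le> c * R"
        using True \<open>c > 0\<close> by (intro mult_left_mono) auto
      also have "c * R = d / 2"
        using \<open>R > 0\<close> by (simp add: c_def)
      finally show ?thesis
        using \<open>c > 0\<close> \<open>d > 0\<close> by (simp add: dist_norm)
    qed
    from d(2)[OF this] have "\<bar>u p / 2\<bar> \<le> \<bar>u (c *\<^sub>R x + p)\<bar>"
      by (simp add: dist_real_def abs_if split: if_splits)
    then have "(u p / 2)\<^sup>2 \<le> (u (c *\<^sub>R x + p))\<^sup>2"
      by (simp only: abs_le_square_iff)
    then have "C * (u p / 2)\<^sup>2 \<le> w x"
      using \<open>C > 0\<close> by (simp add: w_def)
    moreover have "C * (u p / 2)\<^sup>2 = B"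
      using p by (simp add: C_def \<phi>u)
    moreover have "\<bar>u x\<bar> \<le> B"
      using B(2)[of x] by (simp add: \<phi>u)
    ultimately show ?thesis by linarith
  qed
  show thesis
  proof (rule that)
    have "(\<lambda>x. of_real C * (\<phi> (c *\<^sub>R x + p) * \<phi> (c *\<^sub>R x + p))) \<in> test_functions"
      using \<open>c > 0\<close> by (intro test_functions_cmult test_functions_mult test_functions_affine \<phi>) auto
    also have "(\<lambda>x. of_real C * (\<phi> (c *\<^sub>R x + p) * \<phi> (c *\<^sub>R x + p))) = (\<lambda>x. of_real (w x))"
      by (simp add: w_def \<phi>u power2_eq_square)
    finally show "(\<lambda>x. complex_of_real (w x)) \<in> test_functions" .
    show "positive_test (\<lambda>x. complex_of_real (w x))"
      using w by (simp add: positive_test_def)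
    show "positive_test (\<lambda>x. \<phi> x + complex_of_real (w x))"
      using uw by (simp add: positive_test_def \<phi>u flip: of_real_add)
  qed
qed

text \<open>Both sides are linear in \<open>\<phi>\<close>. The limit therefore passes to positive
  functions by scaling, to real ones by subtracting a positive majorant, and to complex ones through
  real and imaginary parts.\<close>

lemma point_value_along_reciprocals:
  fixes f :: "('a::euclidean_space \<Rightarrow> complex) \<Rightarrow> complex"
  assumes f: "distribution f"
    and lim: "\<And>\<phi>. \<phi> \<in> test_functions \<Longrightarrow> positive_test \<phi> \<Longrightarrow> normalized_test \<phi> \<Longrightarrow>
      (\<lambda>n. shift_dilate f x\<^sub>0 (1 / real (Suc n)) \<phi>) \<longlonglongrightarrow> \<gamma>"
    and \<phi>: "\<phi> \<in> test_functions"
  shows "(\<lambda>n. shift_dilate f x\<^sub>0 (1 / real (Suc n)) \<phi>) \<longlonglongrightarrow> \<gamma> * (LINT x|lborel. \<phi> x)"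
proof -
  define Q where "Q \<phi> \<longleftrightarrow> (\<lambda>n. shift_dilate f x\<^sub>0 (1 / real (Suc n)) \<phi>) \<longlonglongrightarrow> \<gamma> * (LINT x|lborel. \<phi> x)" for \<phi>
  have Q_cmult: "Q (\<lambda>x. c * \<phi> x)" if "Q \<phi>" "\<phi> \<in> test_functions" for c \<phi>
    using tendsto_mult_left[OF that(1)[unfolded Q_def], of c] that(2)
    unfolding Q_def by (simp add: shift_dilate_cmult[OF f] mult.left_commute)
  have Q_add: "Q (\<lambda>x. \<phi> x + \<psi> x)" if "Q \<phi>" "Q \<psi>" "\<phi> \<in> test_functions" "\<psi> \<in> test_functions" for \<phi> \<psi>
    using tendsto_add[OF that(1,2)[unfolded Q_def]] that(3,4)
    unfolding Q_def by (simp add: shift_dilate_add[OF f] integral_test_add ring_distribs)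
  \<comment> \<open>Division by the integral normalizes \<open>\<phi>\<close>, unless the integral
    is 0 and \<open>\<phi>\<close> is the zero function.\<close>
  have Q_pos: "Q \<phi>" if "\<phi> \<in> test_functions" "positive_test \<phi>" for \<phi>
  proof (cases "(LINT x|lborel. \<phi> x) = 0")
    case True
    then have "\<phi> = (\<lambda>x. 0)"
      using test_nonneg_integral_0[OF that] by auto
    then show ?thesis
      by (simp add: Q_def shift_dilate_def distribution_0[OF f])
  next
    case False
    define I where "I = (LINT x|lborel. Re (\<phi> x))"
    have "\<phi> x \<in> \<real>\<^sub>\<ge>\<^sub>0" for x
      using that(2) by (simp add: positive_test_def)
    then have re: "\<phi> x = of_real (Re (\<phi> x))" "0 \<le> Re (\<phi> x)" for x
      by (simp_all add: complex_nonneg_Reals_iff complex_eq_iff)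
    have I: "(LINT x|lborel. \<phi> x) = of_real I"
      unfolding I_def by (subst re(1)) simp
    moreover have "I \<ge> 0"
      unfolding I_def using re(2) by simp
    ultimately have "I > 0" using False by auto
    let ?\<psi> = "\<lambda>x. of_real (1 / I) * \<phi> x"
    have \<psi>: "?\<psi> \<in> test_functions"
      by (rule test_functions_cmult[OF that(1)])
    have pos: "positive_test ?\<psi>"
      using that(2) \<open>I > 0\<close> unfolding positive_test_def by (auto intro!: nonneg_Reals_mult_I)
    have int: "(LINT x|lborel. ?\<psi> x) = 1"
      using \<open>I > 0\<close> by (simp add: I)
    then have "normalized_test ?\<psi>"
      by (simp only: normalized_test_def)
    from lim[OF \<psi> pos this] have "Q ?\<psi>"
      unfolding Q_def int by (simp only: mult_1_right)
    from Q_cmult[OF this \<psi>, of "of_real I"] show ?thesis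
      using \<open>I > 0\<close> by simp
  qed
  have Q_real: "Q \<phi>" if real: "\<phi> \<in> test_functions" "\<And>x. \<phi> x \<in> \<real>" for \<phi>
  proof -
    obtain \<eta> where \<eta>: "\<eta> \<in> test_functions" "positive_test \<eta>" "positive_test (\<lambda>x. \<phi> x + \<eta> x)"
      using real_test_positive_majorant[OF real] .
    have "Q (\<lambda>x. (\<phi> x + \<eta> x) + (- 1) * \<eta> x)"
      by (intro Q_add Q_cmult Q_pos \<eta> test_functions_add test_functions_cmult real)
    then show ?thesis by simp
  qed
  have "Q (\<lambda>x. of_real (Re (\<phi> x)) + \<i> * of_real (Im (\<phi> x)))"
    by (intro Q_add Q_cmult Q_real test_functions_cmult test_functions_bounded_linear[OF _ \<phi>]
          bounded_linear_compose[OF bounded_linear_of_real] bounded_linear_Re bounded_linear_Im) auto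
  then show ?thesis
    by (simp add: Q_def flip: complex_eq)
qed

section \<open>From reciprocals of integers to a continuous parameter\<close>

text \<open>An arbitrary sequence of parameters is compared with the reciprocals of integers just
  above it. The comparison changes the test function by a null sequence, on which the gliding hump
  makes the error tend to 0.\<close>

lemma point_value_at_right:
  fixes f :: "('a::euclidean_space \<Rightarrow> complex) \<Rightarrow> complex"
  assumes f: "distribution f"
    and lim: "\<And>\<phi>. \<phi> \<in> test_functions \<Longrightarrow>
      (\<lambda>n. shift_dilate f x\<^sub>0 (1 / real (Suc n)) \<phi>) \<longlonglongrightarrow> \<gamma> * (LINT x|lborel. \<phi> x)"
    and \<phi>: "\<phi> \<in> test_functions"
  shows "((\<lambda>\<epsilon>. shift_dilate f x\<^sub>0 \<epsilon> \<phi>) \<longlongrightarrow> \<gamma> * (LINT x|lborel. \<phi> x)) (at_right 0)"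
proof -
  \<comment> \<open>Restricting to parameters at most 1 makes the integer part of their reciprocals
    at least 1 without affecting the limit from the right.\<close>
  have "((\<lambda>\<epsilon>. shift_dilate f x\<^sub>0 \<epsilon> \<phi>) \<longlongrightarrow> \<gamma> * (LINT x|lborel. \<phi> x)) (at 0 within {0..1})"
    unfolding tendsto_at_iff_sequentially
  proof (intro allI impI)
    fix X :: "nat \<Rightarrow> real"
    assume "\<forall>i. X i \<in> {0..1} - {0}" and X0: "X \<longlonglongrightarrow> 0"
    then have X: "0 < X k" "X k \<le> 1" for k by (auto simp: less_le)
    \<comment> \<open>\<open>Suc (N k)\<close> is the integer part of \<open>1 / X k\<close>; the
      subtraction of 1 matches the indexing by \<open>Suc n\<close> in \<open>lim\<close>.\<close>
    define N where "N k = nat \<lfloor>1 / X k\<rfloor> - 1" for k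
    have N: "real (Suc (N k)) \<le> 1 / X k" "1 / X k < real (Suc (N k)) + 1" for k
    proof -
      have "1 \<le> \<lfloor>1 / X k\<rfloor>"
        using X[of k] by simp
      then have "real (Suc (N k)) = of_int \<lfloor>1 / X k\<rfloor>"
        unfolding N_def by linarith
      then show "real (Suc (N k)) \<le> 1 / X k" "1 / X k < real (Suc (N k)) + 1"
        by linarith+
    qed
    have "filterlim (\<lambda>k. 1 / X k) at_top sequentially"
      using filterlim_inverse_at_top[OF X0] X(1) by (simp add: inverse_eq_divide)
    \<comment> \<open>The upper bound in \<open>N\<close> says that
      \<open>1 / X k - 2 < real (N k)\<close>.\<close>
    then have "filterlim (\<lambda>k. 1 / X k + (- 2)) at_top sequentially"
      using filterlim_tendsto_add_at_top[OF tendsto_const[of "- 2"]] by (simp add: add.commute)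
    then have "filterlim (\<lambda>k. real (N k)) at_top sequentially"
      by (rule filterlim_at_top_mono) (use N(2) in \<open>auto intro!: always_eventually simp: algebra_simps less_imp_le\<close>)
    then have Nlim: "filterlim N at_top sequentially"
      by (simp add: filterlim_sequentially_iff_filterlim_real)
    define c where "c k = 1 / (X k * real (Suc (N k)))" for k
    have c_eq: "c k = (1 / X k) / real (Suc (N k))" for k
      by (simp add: c_def)
    have c1: "1 \<le> c k" for k
      unfolding c_eq using N(1)[of k] by (subst le_divide_eq_1_pos) auto
    have c2: "c k \<le> 1 + 1 / real (Suc (N k))" for k
    proof -
      have "c k \<le> (real (Suc (N k)) + 1) / real (Suc (N k))"
        unfolding c_eq using N(2)[of k] by (intro divide_right_mono) auto
      also have "\<dots> = 1 + 1 / real (Suc (N k))"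
        by (subst add_divide_distrib) (simp del: of_nat_Suc)
      finally show ?thesis .
    qed
    have c: "c \<longlonglongrightarrow> 1"
    proof (rule tendsto_sandwich)
      show "\<forall>\<^sub>F k in sequentially. 1 \<le> c k" "\<forall>\<^sub>F k in sequentially. c k \<le> 1 + 1 / real (Suc (N k))"
        using c1 c2 by auto
      have "(\<lambda>k. 1 + 1 / real (Suc (N k))) \<longlonglongrightarrow> 1 + 0"
        by (intro tendsto_add tendsto_const filterlim_compose[OF LIMSEQ_Suc[OF lim_1_over_n] Nlim])
      then show "(\<lambda>k. 1 + 1 / real (Suc (N k))) \<longlonglongrightarrow> 1" by simp
    qed simp
    obtain R where R: "R > 0" "{x. \<phi> x \<noteq> 0} \<subseteq> cball 0 R"
      using test_supported_in_cball[OF \<phi>] .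
    \<comment> \<open>The error of the claimed limit at the index \<open>N k\<close>. It is
      additive, continuous along null sequences and pointwise convergent to 0, as
      \<open>gliding_hump\<close> requires.\<close>
    define T where "T k \<psi> = shift_dilate f x\<^sub>0 (1 / real (Suc (N k))) \<psi> - \<gamma> * (LINT x|lborel. \<psi> x)" for k \<psi>
    let ?\<psi> = "\<lambda>k x. \<phi> (c k *\<^sub>R x) - \<phi> x"
    have Tadd: "T k (\<lambda>x. \<phi> x + \<psi> x) = T k \<phi> + T k \<psi>"
      if "\<phi> \<in> test_functions" "\<psi> \<in> test_functions" for k \<phi> \<psi>
      using that unfolding T_def by (simp add: shift_dilate_add[OF f] integral_test_add algebra_simps)
    have Tpw: "(\<lambda>k. T k \<phi>) \<longlonglongrightarrow> 0" if "\<phi> \<in> test_functions" for \<phi>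
      unfolding T_def using filterlim_compose[OF lim[OF that] Nlim] by (simp add: LIM_zero_iff)
    have null: "test_null_seq (cball 0 R) ?\<psi>"
      by (intro test_null_seq_dilation \<phi> R c1 c)
    have T\<psi>: "(\<lambda>k. T k (?\<psi> k)) \<longlonglongrightarrow> 0"
    proof (rule gliding_hump[OF compact_cball Tadd _ Tpw null])
      fix k and g :: "nat \<Rightarrow> 'a \<Rightarrow> complex"
      assume g: "test_null_seq (cball 0 R) g"
      have "(\<lambda>m. T k (g m)) \<longlonglongrightarrow> 0 - \<gamma> * 0"
        unfolding T_def
        by (intro tendsto_diff tendsto_mult tendsto_const shift_dilate_test_null_seq[OF f _ compact_cball g]
              integral_test_null_seq[OF compact_cball g]) simp
      then show "(\<lambda>m. T k (g m)) \<longlonglongrightarrow> 0" by simp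
    qed
    \<comment> \<open>The dilated function is written as \<open>?\<psi> k\<close> plus
      \<open>\<phi>\<close>. The factor \<open>c k ^ DIM('a)\<close> cancels against the Jacobian of
      the dilated integral, so the term with \<gamma> appears without it.\<close>
    have eq: "shift_dilate f x\<^sub>0 (X k) \<phi> =
        of_real (c k ^ DIM('a)) * (T k (?\<psi> k) + T k \<phi>) + \<gamma> * (LINT x|lborel. \<phi> x)" for k
    proof -
      have pos: "c k > 0" using c1[of k] by linarith
      have \<psi>t: "?\<psi> k \<in> test_functions"
        using null by (simp add: test_null_seq_def)
      have Xk: "X k = (1 / real (Suc (N k))) / c k"
        using X[of k] by (simp add: c_def)
      have "shift_dilate f x\<^sub>0 (X k) \<phi> =
          of_real (\<bar>c k\<bar> ^ DIM('a)) * shift_dilate f x\<^sub>0 (1 / real (Suc (N k))) (\<lambda>x. \<phi> (c k *\<^sub>R x))"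
        unfolding Xk using pos by (intro shift_dilate_mult) simp
      also have "shift_dilate f x\<^sub>0 (1 / real (Suc (N k))) (\<lambda>x. \<phi> (c k *\<^sub>R x)) =
          T k (\<lambda>x. ?\<psi> k x + \<phi> x) + \<gamma> * (LINT x|lborel. \<phi> (c k *\<^sub>R x))"
        by (simp add: T_def)
      also have "T k (\<lambda>x. ?\<psi> k x + \<phi> x) = T k (?\<psi> k) + T k \<phi>"
        by (rule Tadd[OF \<psi>t \<phi>])
      finally have "shift_dilate f x\<^sub>0 (X k) \<phi> = of_real (c k ^ DIM('a)) * (T k (?\<psi> k) + T k \<phi>)
          + \<gamma> * (of_real (c k ^ DIM('a)) * (LINT x|lborel. \<phi> (c k *\<^sub>R x)))"
        using pos by (simp add: algebra_simps)
      moreover have "of_real (c k ^ DIM('a)) * (LINT x|lborel. \<phi> (c k *\<^sub>R x)) = (LINT x|lborel. \<phi> x)"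
        using pos by (simp add: integral_dilation[OF \<phi>])
      ultimately show ?thesis
        by simp
    qed
    have "(\<lambda>k. of_real (c k ^ DIM('a)) * (T k (?\<psi> k) + T k \<phi>) + \<gamma> * (LINT x|lborel. \<phi> x)) \<longlonglongrightarrow>
        of_real (1 ^ DIM('a)) * (0 + 0) + \<gamma> * (LINT x|lborel. \<phi> x)"
      by (intro tendsto_intros c T\<psi> Tpw \<phi>)
    then show "((\<lambda>\<epsilon>. shift_dilate f x\<^sub>0 \<epsilon> \<phi>) \<circ> X) \<longlonglongrightarrow> \<gamma> * (LINT x|lborel. \<phi> x)"
      by (simp add: o_def eq)
  qed
  then show ?thesis
    by (simp add: at_within_Icc_at_right)
qed

theorem proposition7p3:
  fixes f :: "('a::euclidean_space \<Rightarrow> complex) \<Rightarrow> complex"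
    and x\<^sub>0 :: 'a
    and \<gamma> :: complex
  assumes "distribution f"
  shows "has_point_value f x\<^sub>0 \<gamma> \<longleftrightarrow>
    (\<forall>\<phi>\<in>test_functions. positive_test \<phi> \<and> normalized_test \<phi> \<longrightarrow>
       (\<lambda>n. shift_dilate f x\<^sub>0 1 (standard_delta_seq \<phi> n)) \<longlonglongrightarrow> \<gamma>)"
proof -
  \<comment> \<open>Passing to \<open>Suc n\<close> discards the meaningless term
    \<open>n = 0\<close> of the delta sequence.\<close>
  have delta: "(\<lambda>n. shift_dilate f x\<^sub>0 1 (standard_delta_seq \<phi> n)) \<longlonglongrightarrow> l \<longleftrightarrow>
      (\<lambda>n. shift_dilate f x\<^sub>0 (1 / real (Suc n)) \<phi>) \<longlonglongrightarrow> l" if "\<phi> \<in> test_functions" for \<phi> l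
    by (subst filterlim_sequentially_Suc[symmetric])
       (simp add: shift_dilate_standard_delta_seq[OF assms _ that])
  show ?thesis
  proof (intro iffI ballI impI)
    fix \<phi> :: "'a \<Rightarrow> complex"
    assume pv: "has_point_value f x\<^sub>0 \<gamma>" and \<phi>: "\<phi> \<in> test_functions"
      and "positive_test \<phi> \<and> normalized_test \<phi>"
    then have "((\<lambda>\<epsilon>. shift_dilate f x\<^sub>0 \<epsilon> \<phi>) \<longlongrightarrow> \<gamma>) (at 0)"
      unfolding has_point_value_def normalized_test_def by fastforce
    moreover have "filterlim (\<lambda>n. 1 / real (Suc n)) (at 0) sequentially"
      using LIMSEQ_Suc[OF lim_1_over_n] by (simp add: filterlim_at)
    ultimately show "(\<lambda>n. shift_dilate f x\<^sub>0 1 (standard_delta_seq \<phi> n)) \<longlonglongrightarrow> \<gamma>"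
      unfolding delta[OF \<phi>] by (rule filterlim_compose)
  next
    assume *: "\<forall>\<phi>\<in>test_functions. positive_test \<phi> \<and> normalized_test \<phi> \<longrightarrow>
       (\<lambda>n. shift_dilate f x\<^sub>0 1 (standard_delta_seq \<phi> n)) \<longlonglongrightarrow> \<gamma>"
    have right: "((\<lambda>\<epsilon>. shift_dilate f x\<^sub>0 \<epsilon> \<phi>) \<longlongrightarrow> \<gamma> * (LINT x|lborel. \<phi> x)) (at_right 0)"
      if "\<phi> \<in> test_functions" for \<phi>
      by (intro point_value_at_right[OF assms] point_value_along_reciprocals[OF assms] that)
         (use * delta in auto)
    show "has_point_value f x\<^sub>0 \<gamma>"
      unfolding has_point_value_def
    proof (intro ballI filterlim_split_at)
      fix \<phi> :: "'a \<Rightarrow> complex" assume \<phi>: "\<phi> \<in> test_functions"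
      then show "((\<lambda>\<epsilon>. shift_dilate f x\<^sub>0 \<epsilon> \<phi>) \<longlongrightarrow> \<gamma> * (LINT x|lborel. \<phi> x)) (at_right 0)"
        by (rule right)
      \<comment> \<open>The limit from the left for \<open>\<phi>\<close> is the limit from the
        right for its reflection, which has the same integral.\<close>
      have "(\<lambda>x. \<phi> (- x)) \<in> test_functions"
        using test_functions_affine[OF \<phi>, of "- 1" 0] by simp
      from right[OF this] show "((\<lambda>\<epsilon>. shift_dilate f x\<^sub>0 \<epsilon> \<phi>) \<longlongrightarrow> \<gamma> * (LINT x|lborel. \<phi> x)) (at_left 0)"
        using integral_dilation[OF \<phi>, of "- 1"] shift_dilate_mult[of "- 1" f x\<^sub>0 _ \<phi>]
        by (simp add: filterlim_at_left_to_right[of _ _ "0::real"])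
    qed
  qed
qed

end
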